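(* Let $g:\mathbb{N}\to\mathbb{R}$ be a strongly additive function, i.e. $g(p^{k})=g(p)$ for all primes $p$ and integers $k\ge 1$, and $g(mn)=g(m)+g(n)$ whenever $\gcd(m,n)=1$. For each $n\ge 2$ let $\rho_n$ be the probability measure on $\mathbb{R}$ given, for Borel $A\subset\mathbb{R}$, by $$\rho_{n}(A)=\frac{\sum_{p\le n,\ g(p)\in A}\frac1p}{\sum_{p\le n}\frac1p}.$$ Assume there exists a probability measure $\rho$ on $\mathbb{R}$ such that for every $\theta\in\mathbb{R}$, $\int_{\mathbb{R}}e^{\theta y}\,\rho(dy)<\infty$ and $\int_{\mathbb{R}}e^{\theta y}\,\rho_n(dy)\to\int_{\mathbb{R}}e^{\theta y}\,\rho(dy)$ as $n\to\infty$. Let $V(n)$ be a random integer chosen uniformly from $\{1,2,\ldots,n\}$ and let $X(n):=g(V(n))$. Then the laws $\mathbb{P}\left(\frac{X(n)}{\log\log n}\in\cdot\right)$ satisfy a large deviation principle on $\mathbb{R}$ with speed $\log\log n$ and rate function $$I(x):=\sup_{\theta\in\mathbb{R}}\left\{\theta x-\int_{\mathbb{R}}(e^{\theta y}-1)\,\rho(dy)\right\}.$$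
   Context: Throughout, $p$ denotes a prime number, and sums over $p\le n$ are over primes. A sequence $(P_n)$ of probability measures on a topological space $X$ satisfies the large deviation principle with speed $b_n$ and rate function $I:X\to\mathbb{R}\cup\{\infty\}$ if $I$ is non-negative, lower semicontinuous and for every measurable set $A$, $$-\inf_{x\in A^{o}}I(x)\le\liminf_{n\to\infty}\frac1{b_n}\log P_n(A)\le\limsup_{n\to\infty}\frac1{b_n}\log P_n(A)\le-\inf_{x\in\overline{A}}I(x),$$ where $A^{o}$ is the interior and $\overline{A}$ the closure of $A$. Here $\log 0=-\infty$ and the infimum over the empty set is $+\infty$. Only $n$ large enough that $\log\log n>0$ is considered. *)

theory Defs
  imports "HOL-Probability.Probability" "HOL-Computational_Algebra.Primes"
begin

definition strongly_additive :: "(nat \<Rightarrow> real) \<Rightarrow> bool" where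
  "strongly_additive g \<longleftrightarrow>
     (\<forall>p k. prime p \<longrightarrow> k \<ge> 1 \<longrightarrow> g (p ^ k) = g p) \<and>
     (\<forall>m n. m \<ge> 1 \<longrightarrow> n \<ge> 1 \<longrightarrow> coprime m n \<longrightarrow> g (m * n) = g m + g n)"

text \<open>The push-forward under \<open>g\<close> of the measure on the primes up to \<open>n\<close> with weights
  proportional to \<open>1 / p\<close>; \<open>measure_prime_law\<close> below gives its values on Borel sets.\<close>

definition prime_law :: "(nat \<Rightarrow> real) \<Rightarrow> nat \<Rightarrow> real measure" where
  "prime_law g n =
     distr (point_measure {p. prime p \<and> p \<le> n}
              (\<lambda>p. ennreal ((1 / real p) / (\<Sum>q | prime q \<and> q \<le> n. 1 / real q)))) borel g"

lemma sets_prime_law [simp]: "sets (prime_law g n) = sets borel"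
  by (simp add: prime_law_def)

lemma emeasure_prime_law:
  assumes A: "A \<in> sets borel"
  shows "emeasure (prime_law g n) A =
    ennreal ((\<Sum>p | prime p \<and> p \<le> n \<and> g p \<in> A. 1 / real p) /
             (\<Sum>p | prime p \<and> p \<le> n. 1 / real p))"
proof -
  let ?P = "{p::nat. prime p \<and> p \<le> n}"
  let ?w = "\<lambda>p::nat. ennreal ((1 / real p) / (\<Sum>q\<in>?P. 1 / real q))"
  have fin: "finite ?P"
    by (rule finite_subset[of _ "{..n}"]) auto
  have m: "g \<in> measurable (point_measure ?P ?w) borel"
    by simp
  have eq: "g -` A \<inter> ?P = {p. prime p \<and> p \<le> n \<and> g p \<in> A}"
    by auto
  have "emeasure (prime_law g n) A = emeasure (point_measure ?P ?w) (g -` A \<inter> ?P)"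
    unfolding prime_law_def using emeasure_distr[OF m A] by (simp add: space_point_measure)
  also have "\<dots> = (\<Sum>p\<in>g -` A \<inter> ?P. ?w p)"
    using fin by (intro emeasure_point_measure_finite) auto
  also have "\<dots> = ennreal (\<Sum>p\<in>g -` A \<inter> ?P. (1 / real p) / (\<Sum>q\<in>?P. 1 / real q))"
    by (intro sum_ennreal divide_nonneg_nonneg sum_nonneg) auto
  finally show ?thesis
    by (simp only: eq sum_divide_distrib)
qed

lemma measure_prime_law:
  assumes "A \<in> sets borel"
  shows "measure (prime_law g n) A =
    (\<Sum>p | prime p \<and> p \<le> n \<and> g p \<in> A. 1 / real p) / (\<Sum>p | prime p \<and> p \<le> n. 1 / real p)"
  unfolding measure_def emeasure_prime_law[OF assms]
  by (intro enn2real_ennreal divide_nonneg_nonneg sum_nonneg) auto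

lemma prob_space_prime_law:
  assumes "n \<ge> 2"
  shows "prob_space (prime_law g n)"
proof
  let ?P = "{p::nat. prime p \<and> p \<le> n}"
  have "finite ?P"
    by (rule finite_subset[of _ "{..n}"]) auto
  moreover have "2 \<in> ?P"
    using assms by (simp add: two_is_prime_nat)
  moreover have "1 / real p > 0" if "p \<in> ?P" for p
    using that by (auto simp: prime_gt_0_nat)
  ultimately have "(\<Sum>p\<in>?P. 1 / real p) > 0"
    by (intro sum_pos2[where i = 2]) auto
  then show "emeasure (prime_law g n) (space (prime_law g n)) = 1"
    by (subst emeasure_prime_law) (auto simp: prime_law_def)
qed

text \<open>The logarithm of a probability, with the convention \<open>log 0 = -\<infinity>\<close>
  (whereas \<open>ln 0 = 0\<close> on the reals).\<close>

definition ext_ln :: "real \<Rightarrow> ereal" where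
  "ext_ln r = (if r > 0 then ereal (ln r) else - \<infinity>)"

definition lower_semicontinuous :: "('a::topological_space \<Rightarrow> ereal) \<Rightarrow> bool" where
  "lower_semicontinuous f \<longleftrightarrow> (\<forall>c. closed {x. f x \<le> c})"

text \<open>Infima are taken in \<open>ereal\<close>, so the infimum over the empty set is \<open>\<infinity>\<close>.
  The values of \<open>P n\<close> and \<open>b n\<close> for small \<open>n\<close> do not influence the bounds, so \<open>b n > 0\<close> is
  only relevant for large \<open>n\<close>.\<close>

definition large_deviation_principle ::
  "(nat \<Rightarrow> 'a::topological_space measure) \<Rightarrow> (nat \<Rightarrow> real) \<Rightarrow> ('a \<Rightarrow> ereal) \<Rightarrow> bool" where
  "large_deviation_principle P b I \<longleftrightarrow>
     (\<forall>n. prob_space (P n) \<and> sets (P n) = sets borel) \<and>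
     (\<forall>x. 0 \<le> I x) \<and>
     lower_semicontinuous I \<and>
     (\<forall>A\<in>sets borel.
        - (INF x\<in>interior A. I x) \<le> liminf (\<lambda>n. ereal (1 / b n) * ext_ln (measure (P n) A)) \<and>
        liminf (\<lambda>n. ereal (1 / b n) * ext_ln (measure (P n) A))
          \<le> limsup (\<lambda>n. ereal (1 / b n) * ext_ln (measure (P n) A)) \<and>
        limsup (\<lambda>n. ereal (1 / b n) * ext_ln (measure (P n) A)) \<le> - (INF x\<in>closure A. I x))"

end

theory Submission
  imports Defs "HOL-Library.Log_Nat" "HOL-Computational_Algebra.Squarefree"
    "HOL-Real_Asymp.Real_Asymp"
begin

text \<open>
  Put \<open>L = ln (ln n)\<close> and \<open>M \<theta> = \<integral>y. exp (\<theta> * y) \<partial>\<rho>\<close>. By the Gaertner--Ellis theorem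
  (\<open>gaertner_ellis\<close>) the large deviation principle follows once the logarithm of the mean of
  \<open>exp (\<theta> * g m)\<close> over \<open>m \<le> n\<close>, divided by \<open>L\<close>, is known to tend to the differentiable function
  \<open>M \<theta> - 1\<close>. Heuristically the events \<open>p dvd m\<close> are independent of probability \<open>1 / p\<close>, so the
  mean should be the Euler product of the factors \<open>1 + (exp (\<theta> * g p) - 1) / p\<close> over \<open>p \<le> n\<close>,
  whose logarithm is close to the sum of \<open>(exp (\<theta> * g p) - 1) / p\<close>. The hypothesis on the laws
  \<open>prime_law g n\<close>, combined with \<open>\<Sum>p\<le>n. 1 / p \<sim> L\<close> (\<open>sum_inverse_primes_asymp\<close>), says that this
  sum is asymptotic to \<open>(M \<theta> - 1) * L\<close>.

  The independence heuristic is correct on the logarithmic scale for the primes up to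
  \<open>y = n powr (1 / L\<^sup>2)\<close>. Expanding the product over prime divisors into a sum over squarefree
  \<open>d\<close> and replacing \<open>n div d\<close> by \<open>n / d\<close> costs an error that Rankin's trick
  (\<open>mean_value_error\<close>) bounds by \<open>exp (c * L - L\<^sup>2)\<close>, negligible against an Euler product that is a
  power of \<open>exp L\<close>. The primes between \<open>y\<close> and \<open>n\<close> carry only a proportion \<open>o(1)\<close> of every
  exponential moment sum, because \<open>ln (ln y) \<sim> L\<close>, so the elementary bound
  \<open>mean_value_upper_bound\<close> shows that all exponential moments of their contribution are
  \<open>exp (o(L))\<close>. Hoelder's inequality, in the form that the logarithm of a mean of exponentials is
  convex, glues the two ranges together with exponents tending to \<open>1\<close>
  (\<open>log_mgf_asymp\<close>), and the continuity of \<open>M\<close> gives the limit.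
\<close>

section \<open>The Gaertner--Ellis theorem on the real line\<close>

lemma (in prob_space) integral_exp_pos:
  assumes "integrable M (\<lambda>x. exp (f x :: real))"
  shows "0 < (\<integral>x. exp (f x) \<partial>M)"
proof -
  have "(\<integral>x. exp (f x) \<partial>M) \<noteq> 0"
  proof
    assume "(\<integral>x. exp (f x) \<partial>M) = 0"
    then have "AE x in M. exp (f x) = 0"
      using assms by (subst (asm) integral_nonneg_eq_0_iff_AE) auto
    then show False by simp
  qed
  moreover have "0 \<le> (\<integral>x. exp (f x) \<partial>M)" by simp
  ultimately show ?thesis by linarith
qed

text \<open>The lower bound of the Gaertner--Ellis theorem can be proved directly only at points that are
  derivatives of \<open>\<Lambda>\<close>, and a point of finite rate need not be one (for a convex \<open>\<Lambda>\<close> that is bounded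
  below but has no minimum, \<open>0\<close> is such a point). Subtracting \<open>\<delta> * \<theta>\<^sup>2 / 2\<close>
  from \<open>\<theta> * x - \<Lambda> \<theta>\<close>, as if an independent Gaussian of small variance had been added, forces the
  maximum to be attained. At the maximiser the derivative of \<open>\<Lambda>\<close> is within \<open>O(sqrt \<delta>)\<close> of \<open>x\<close>,
  and the rate there does not exceed the rate at \<open>x\<close>.\<close>

lemma regularised_exposed_point:
  fixes \<Lambda> :: "real \<Rightarrow> real"
  assumes diff: "\<And>\<theta>. \<Lambda> differentiable (at \<theta>)" and zero: "\<Lambda> 0 = 0"
    and J: "\<And>\<theta>. \<theta> * x - \<Lambda> \<theta> \<le> J" and "r > 0"
  obtains \<theta> x' where "(\<Lambda> has_real_derivative x') (at \<theta>)" "\<bar>x' - x\<bar> < r" "\<theta> * x' - \<Lambda> \<theta> \<le> J"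
proof -
  have "J \<ge> 0" using J[of 0] zero by simp
  \<comment> \<open>the maximiser will satisfy \<open>(\<delta> * \<theta>)\<^sup>2 \<le> 2 * \<delta> * J\<close>, which has to be below \<open>r\<^sup>2\<close>\<close>
  define \<delta> where "\<delta> = r\<^sup>2 / (2 * (J + 1))"
  have \<delta>: "\<delta> > 0" "2 * \<delta> * J < r\<^sup>2"
    using \<open>r > 0\<close> \<open>J \<ge> 0\<close> by (auto simp: \<delta>_def field_simps)
  \<comment> \<open>beyond \<open>R\<close> the quadratic penalty exceeds \<open>J\<close>, so that \<open>\<phi>\<close> is below \<open>\<phi> 0 = 0\<close> there\<close>
  define R where "R = sqrt (2 * J / \<delta>) + 1"
  have R: "R > 0" "\<delta> * R\<^sup>2 / 2 > J"
  proof -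
    show "R > 0" using \<delta> \<open>J \<ge> 0\<close> by (simp add: R_def add_nonneg_pos)
    have "sqrt (2 * J / \<delta>) ^ 2 < R ^ 2"
      by (rule power_strict_mono) (use \<delta> \<open>J \<ge> 0\<close> in \<open>auto simp: R_def\<close>)
    then have "2 * J / \<delta> < R\<^sup>2" using \<delta> \<open>J \<ge> 0\<close> by simp
    then show "\<delta> * R\<^sup>2 / 2 > J" using \<delta> by (simp add: field_simps)
  qed
  define \<phi> where "\<phi> = (\<lambda>\<theta>. \<theta> * x - \<Lambda> \<theta> - \<delta> * \<theta>\<^sup>2 / 2)"
  have cont: "continuous_on {-R..R} \<phi>"
  proof -
    have "isCont \<Lambda> \<theta>" for \<theta>
      using diff by (rule differentiable_imp_continuous_within)
    then show ?thesis unfolding \<phi>_def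
      by (intro continuous_intros continuous_at_imp_continuous_on) auto
  qed
  obtain \<theta> where \<theta>: "\<theta> \<in> {-R..R}" "\<And>t. t \<in> {-R..R} \<Longrightarrow> \<phi> t \<le> \<phi> \<theta>"
    using continuous_attains_sup[OF _ _ cont] R by force
  have \<phi>0: "0 \<le> \<phi> \<theta>" using \<theta>(2)[of 0] R zero by (simp add: \<phi>_def)
  have max: "\<phi> t \<le> \<phi> \<theta>" for t
  proof (cases "t \<in> {-R..R}")
    case False
    then have "R\<^sup>2 \<le> t\<^sup>2" using R by (intro abs_le_square_iff[THEN iffD1]) auto
    then have "\<delta> * R\<^sup>2 / 2 \<le> \<delta> * t\<^sup>2 / 2" using \<delta> by simp
    then have "\<phi> t \<le> 0" using J[of t] R by (simp add: \<phi>_def)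
    with \<phi>0 show ?thesis by simp
  qed (use \<theta> in auto)
  obtain x' where x': "(\<Lambda> has_real_derivative x') (at \<theta>)"
    using diff real_differentiable_def by blast
  have "(\<phi> has_real_derivative x - x' - \<delta> * \<theta>) (at \<theta>)"
    unfolding \<phi>_def by (rule derivative_eq_intros x' refl | simp)+
  from DERIV_local_max[OF this zero_less_one] have eq: "x' = x - \<delta> * \<theta>"
    using max by simp
  have "\<delta> * \<theta>\<^sup>2 / 2 \<le> J" using \<phi>0 J[of \<theta>] by (simp add: \<phi>_def)
  then have "(\<delta> * \<theta>)\<^sup>2 \<le> 2 * \<delta> * J"
    using \<delta> by (simp add: power2_eq_square mult_ac mult_left_mono)
  with \<delta> have "\<bar>\<delta> * \<theta>\<bar>\<^sup>2 < r\<^sup>2" by simp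
  then have "\<bar>\<delta> * \<theta>\<bar> < r"
    by (rule power2_less_imp_less) (use \<open>r > 0\<close> in simp)
  moreover have "\<theta> * x' - \<Lambda> \<theta> \<le> J"
  proof -
    have "0 \<le> \<delta> * \<theta>\<^sup>2" using \<delta> by simp
    then show ?thesis using J[of \<theta>] by (simp add: eq algebra_simps power2_eq_square)
  qed
  ultimately show ?thesis using that[OF x'] eq by simp
qed

text \<open>The integrals are moment generating functions of \<open>b n\<close> times a variable with law \<open>P n\<close>, and
  \<open>\<Lambda>\<close> is their limit on the logarithmic scale with speed \<open>b\<close>.\<close>

locale log_mgf_limit =
  fixes P :: "nat \<Rightarrow> real measure" and b :: "nat \<Rightarrow> real" and \<Lambda> :: "real \<Rightarrow> real"
  assumes prob: "\<And>n. prob_space (P n)" and sets_P [measurable_cong, simp]: "\<And>n. sets (P n) = sets borel"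
    and speed: "filterlim b at_top sequentially"
    and integrable_mgf: "\<And>\<theta>. \<forall>\<^sub>F n in sequentially. integrable (P n) (\<lambda>x. exp (b n * \<theta> * x))"
    and lim: "\<And>\<theta>. (\<lambda>n. ln (\<integral>x. exp (b n * \<theta> * x) \<partial>P n) / b n) \<longlonglongrightarrow> \<Lambda> \<theta>"
begin

lemma space_P [simp]: "space (P n) = UNIV"
  using sets_eq_imp_space_eq[OF sets_P[of n]] by simp

lemma mgf_bounds:
  assumes "\<eta> > 0"
  shows "\<forall>\<^sub>F n in sequentially. integrable (P n) (\<lambda>x. exp (b n * \<theta> * x)) \<and>
    exp (b n * (\<Lambda> \<theta> - \<eta>)) \<le> (\<integral>x. exp (b n * \<theta> * x) \<partial>P n) \<and>
    (\<integral>x. exp (b n * \<theta> * x) \<partial>P n) \<le> exp (b n * (\<Lambda> \<theta> + \<eta>))"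
proof -
  have "\<forall>\<^sub>F n in sequentially. \<bar>ln (\<integral>x. exp (b n * \<theta> * x) \<partial>P n) / b n - \<Lambda> \<theta>\<bar> < \<eta>"
    using lim[of \<theta>] assms by (auto simp: tendsto_iff dist_real_def)
  moreover have "\<forall>\<^sub>F n in sequentially. b n > 0"
    using speed by (simp add: filterlim_at_top_dense)
  ultimately show ?thesis using integrable_mgf[of \<theta>]
  proof eventually_elim
    case (elim n)
    interpret prob_space "P n" by (rule prob)
    define M where "M = (\<integral>x. exp (b n * \<theta> * x) \<partial>P n)"
    have "M > 0" unfolding M_def by (rule integral_exp_pos[OF elim(3)])
    have "b n * (\<Lambda> \<theta> - \<eta>) \<le> ln M" "ln M \<le> b n * (\<Lambda> \<theta> + \<eta>)"
      using elim(1,2) unfolding M_def[symmetric] by (auto simp: abs_less_iff field_simps)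
    then have "exp (b n * (\<Lambda> \<theta> - \<eta>)) \<le> M" "M \<le> exp (b n * (\<Lambda> \<theta> + \<eta>))"
      using \<open>M > 0\<close> exp_le_cancel_iff[of "ln M" "b n * (\<Lambda> \<theta> + \<eta>)"] by (simp_all add: ln_ge_iff)
    then show ?case using elim(3) by (simp add: M_def)
  qed
qed

lemma limit_at_0: "\<Lambda> 0 = 0"
proof -
  have "measure (P n) UNIV = 1" for n
    using prob_space.prob_space[OF prob[of n]] by simp
  then have "(\<lambda>n. ln (\<integral>x. exp (b n * 0 * x) \<partial>P n) / b n) = (\<lambda>n. 0)"
    by simp
  then have "(\<lambda>n. 0) \<longlonglongrightarrow> \<Lambda> 0" using lim[of 0] by simp
  then show ?thesis by (simp add: LIMSEQ_const_iff)
qed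

text \<open>Markov's inequality for \<open>exp (b n * \<theta> * x)\<close>. The set is the half-line (if \<open>\<theta> \<noteq> 0\<close>) on which the
  single parameter \<open>\<theta>\<close> already certifies that the Legendre transform exceeds \<open>r\<close>.\<close>

lemma halfline_bound:
  assumes "r' < r"
  shows "\<forall>\<^sub>F n in sequentially. measure (P n) {x. r < \<theta> * x - \<Lambda> \<theta>} \<le> exp (- b n * r')"
proof -
  have "r - r' > 0" using assms by simp
  from mgf_bounds[OF this, of \<theta>] have "\<forall>\<^sub>F n in sequentially. integrable (P n) (\<lambda>x. exp (b n * \<theta> * x)) \<and> (\<integral>x. exp (b n * \<theta> * x) \<partial>P n) \<le> exp (b n * (\<Lambda> \<theta> + (r - r')))"
    by eventually_elim auto
  moreover have "\<forall>\<^sub>F n in sequentially. b n > 0"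
    using speed by (simp add: filterlim_at_top_dense)
  ultimately show ?thesis
  proof eventually_elim
    case (elim n)
    interpret prob_space "P n" by (rule prob)
    have "measure (P n) {x. r < \<theta> * x - \<Lambda> \<theta>} \<le> measure (P n) {x \<in> space (P n). exp (b n * (r + \<Lambda> \<theta>)) \<le> exp (b n * \<theta> * x)}"
    proof (rule finite_measure_mono)
      have "b n * (r + \<Lambda> \<theta>) \<le> b n * \<theta> * x" if "r < \<theta> * x - \<Lambda> \<theta>" for x
      proof -
        have "b n * (r + \<Lambda> \<theta>) \<le> b n * (\<theta> * x)"
          using that elim by (intro mult_left_mono) auto
        then show ?thesis by (simp add: mult.assoc)
      qed
      then show "{x. r < \<theta> * x - \<Lambda> \<theta>} \<subseteq> {x \<in> space (P n). exp (b n * (r + \<Lambda> \<theta>)) \<le> exp (b n * \<theta> * x)}"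
        by auto
    qed simp
    also have "\<dots> \<le> (\<integral>x. exp (b n * \<theta> * x) \<partial>P n) / exp (b n * (r + \<Lambda> \<theta>))"
      using elim by (intro integral_Markov_inequality_measure[where A = "{}"]) auto
    also have "\<dots> \<le> exp (b n * (\<Lambda> \<theta> + (r - r'))) / exp (b n * (r + \<Lambda> \<theta>))"
      using elim by (intro divide_right_mono) auto
    also have "\<dots> = exp (- b n * r')"
      by (simp add: exp_diff[symmetric] algebra_simps)
    finally show ?case .
  qed
qed

abbreviation "legendre \<equiv> (\<lambda>x. SUP \<theta>::real. ereal (\<theta> * x - \<Lambda> \<theta>))"

text \<open>Every point of \<open>closure A\<close> lies in one of the open sets of \<open>halfline_bound\<close>; compactness makes
  finitely many of them suffice, and a finite union costs only a constant factor. The compactness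
  argument is confined to a bounded interval because \<open>\<theta> = 1\<close> and \<open>\<theta> = -1\<close> cover its complement.\<close>

lemma closed_set_upper_bound:
  assumes "A \<in> sets borel" and r: "ereal r < (INF x\<in>closure A. legendre x)"
  shows "\<forall>\<^sub>F n in sequentially. measure (P n) A \<le> exp (- b n * r)"
proof -
  obtain r1 where r1: "r < r1" "ereal r1 < (INF x\<in>closure A. legendre x)"
    using ereal_dense3[OF r] by (auto simp: less_ereal.simps(1))
  define U where "U = (\<lambda>\<theta>. {x. r1 < \<theta> * x - \<Lambda> \<theta>})"
  define K where "K = closure A \<inter> {- (r1 + \<Lambda> (-1))..r1 + \<Lambda> 1}"
  have cover: "\<exists>\<theta>. x \<in> U \<theta>" if "x \<in> closure A" for x
  proof -
    have "ereal r1 < legendre x" using r1(2) that by (rule less_INF_D)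
    then show ?thesis by (auto simp: less_SUP_iff U_def)
  qed
  have "compact K" unfolding K_def by (intro closed_Int_compact) auto
  moreover have "open (U \<theta>)" for \<theta>
    unfolding U_def by (intro open_Collect_less continuous_intros)
  moreover have "K \<subseteq> (\<Union>\<theta>\<in>UNIV. U \<theta>)" using cover by (auto simp: K_def)
  ultimately obtain T0 where T0: "finite T0" "K \<subseteq> (\<Union>\<theta>\<in>T0. U \<theta>)"
    using compactE_image[of K UNIV U] by metis
  define T where "T = T0 \<union> {1, -1}"
  have T: "finite T" "T \<noteq> {}" using T0 by (auto simp: T_def)
  have "A \<subseteq> (\<Union>\<theta>\<in>T. U \<theta>)"
  proof
    fix x assume "x \<in> A"
    then have "x \<in> closure A" using closure_subset by blast
    show "x \<in> (\<Union>\<theta>\<in>T. U \<theta>)"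
    proof (cases "x \<in> K")
      case True then show ?thesis using T0 by (auto simp: T_def)
    next
      case False
      then have "x \<in> U 1 \<or> x \<in> U (-1)" using \<open>x \<in> closure A\<close> by (auto simp: K_def U_def)
      then show ?thesis by (auto simp: T_def)
    qed
  qed
  have meas: "U \<theta> \<in> sets borel" for \<theta>
    using \<open>\<And>\<theta>. open (U \<theta>)\<close> by simp
  define r2 where "r2 = (r + r1) / 2"
  have r2: "r < r2" "r2 < r1" using r1 by (auto simp: r2_def)
  have "\<forall>\<^sub>F n in sequentially. \<forall>\<theta>\<in>T. measure (P n) (U \<theta>) \<le> exp (- b n * r2)"
    unfolding U_def using T r2 by (intro eventually_ball_finite ballI halfline_bound) auto
  moreover have "\<forall>\<^sub>F n in sequentially. b n \<ge> ln (real (card T)) / (r2 - r)"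
    using speed by (simp add: filterlim_at_top)
  ultimately show ?thesis
  proof eventually_elim
    case (elim n)
    interpret prob_space "P n" by (rule prob)
    have "measure (P n) A \<le> measure (P n) (\<Union>\<theta>\<in>T. U \<theta>)"
      using \<open>A \<subseteq> _\<close> T meas by (intro finite_measure_mono) auto
    also have "\<dots> \<le> (\<Sum>\<theta>\<in>T. measure (P n) (U \<theta>))"
      using T meas by (intro finite_measure_subadditive_finite) auto
    also have "\<dots> \<le> (\<Sum>\<theta>\<in>T. exp (- b n * r2))"
      using elim by (intro sum_mono) auto
    also have "\<dots> = exp (ln (real (card T))) * exp (- b n * r2)"
      using T by (simp add: card_gt_0_iff)
    also have "\<dots> \<le> exp (b n * (r2 - r)) * exp (- b n * r2)"
      using elim r2 by (intro mult_right_mono) (auto simp: field_simps)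
    also have "\<dots> = exp (- b n * r)" by (simp add: exp_add[symmetric] algebra_simps)
    finally show ?case .
  qed
qed

text \<open>The change of measure argument without the tilted measure: in the integral of
  \<open>exp (b n * \<theta> * y)\<close> the part over \<open>y \<ge> x + \<epsilon>\<close> is bounded using the parameter \<open>\<theta> + s\<close>, the part
  over \<open>y \<le> x - \<epsilon>\<close> using \<open>\<theta> - s\<close>. As \<open>x\<close> is the derivative of \<open>\<Lambda>\<close> at \<open>\<theta>\<close>, both are exponentially
  smaller than the whole for small \<open>s\<close>, so the integral lives near \<open>x\<close>, where the integrand is at
  most \<open>exp (b n * (\<theta> * x + \<bar>\<theta>\<bar> * \<epsilon>))\<close>.\<close>

lemma exposed_point_lower_bound:
  assumes der: "(\<Lambda> has_real_derivative x) (at \<theta>)" and "\<epsilon> > 0"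
  shows "\<forall>\<^sub>F n in sequentially.
    exp (- b n * (\<theta> * x - \<Lambda> \<theta> + \<bar>\<theta>\<bar> * \<epsilon> + \<epsilon>)) \<le> measure (P n) {x - \<epsilon><..<x + \<epsilon>}"
proof -
  obtain d where d: "d > 0" "\<And>h. h \<noteq> 0 \<Longrightarrow> \<bar>h\<bar> < d \<Longrightarrow> \<bar>(\<Lambda> (\<theta> + h) - \<Lambda> \<theta>) / h - x\<bar> < \<epsilon> / 2"
    using LIM_D[OF DERIV_D[OF der], of "\<epsilon> / 2"] \<open>\<epsilon> > 0\<close> by auto
  define s where "s = d / 2"
  have s: "s > 0" "s < d" using d by (auto simp: s_def)
  have up: "\<Lambda> (\<theta> + s) - s * (x + \<epsilon>) \<le> \<Lambda> \<theta> - s * \<epsilon> / 2"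
  proof -
    have "\<bar>(\<Lambda> (\<theta> + s) - \<Lambda> \<theta>) / s - x\<bar> < \<epsilon> / 2" by (rule d(2)) (use s in auto)
    then have "(\<Lambda> (\<theta> + s) - \<Lambda> \<theta>) / s < x + \<epsilon> / 2" by linarith
    then show ?thesis using s by (simp add: field_simps)
  qed
  have dn: "\<Lambda> (\<theta> - s) + s * (x - \<epsilon>) \<le> \<Lambda> \<theta> - s * \<epsilon> / 2"
  proof -
    have "\<bar>(\<Lambda> (\<theta> + - s) - \<Lambda> \<theta>) / (- s) - x\<bar> < \<epsilon> / 2" by (rule d(2)) (use s in auto)
    also have "(\<Lambda> (\<theta> + - s) - \<Lambda> \<theta>) / (- s) = (\<Lambda> \<theta> - \<Lambda> (\<theta> - s)) / s"
      using s by (simp add: field_simps)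
    finally have "x - \<epsilon> / 2 < (\<Lambda> \<theta> - \<Lambda> (\<theta> - s)) / s"
      by linarith
    then show ?thesis using s by (simp add: field_simps)
  qed
  \<comment> \<open>the tails lose \<open>s * \<epsilon> / 2\<close> in the exponent, of which the two errors \<open>\<eta>\<close> take at most half\<close>
  define \<eta> where "\<eta> = min (s * \<epsilon> / 8) (\<epsilon> / 2)"
  have \<eta>: "\<eta> > 0" "\<eta> \<le> s * \<epsilon> / 8" "\<eta> \<le> \<epsilon> / 2" using s \<open>\<epsilon> > 0\<close> by (auto simp: \<eta>_def)
  have "s * \<epsilon> > 0" using s \<open>\<epsilon> > 0\<close> by simp
  have "\<forall>\<^sub>F n in sequentially. b n \<ge> max (ln 4 / (s * \<epsilon> / 4)) (ln 2 / (\<epsilon> / 2))"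
    using speed unfolding filterlim_at_top by blast
  moreover have "\<forall>\<^sub>F n in sequentially. b n > 0"
    using speed by (simp add: filterlim_at_top_dense)
  moreover note mgf_bounds[OF \<eta>(1), of \<theta>] mgf_bounds[OF \<eta>(1), of "\<theta> + s"] mgf_bounds[OF \<eta>(1), of "\<theta> - s"]
  ultimately show ?thesis
  proof eventually_elim
    case (elim n)
    interpret prob_space "P n" by (rule prob)
    let ?B = "{x - \<epsilon><..<x + \<epsilon>}"
    define c where "c = exp (b n * (\<theta> * x + \<bar>\<theta>\<bar> * \<epsilon>))"
    define c1 where "c1 = exp (- b n * s * (x + \<epsilon>))"
    define c2 where "c2 = exp (b n * s * (x - \<epsilon>))"
    define M where "M = (\<lambda>\<theta>. \<integral>x. exp (b n * \<theta> * x) \<partial>P n)"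
    have pw: "exp (b n * \<theta> * y) \<le> c * indicator ?B y + (c1 * exp (b n * (\<theta> + s) * y) + c2 * exp (b n * (\<theta> - s) * y))" for y
    proof -
      consider "y \<in> ?B" | "y \<ge> x + \<epsilon>" | "y \<le> x - \<epsilon>" by fastforce
      then show ?thesis
      proof cases
        case 1
        have "\<theta> * (y - x) \<le> \<bar>\<theta>\<bar> * \<bar>y - x\<bar>" by (metis abs_ge_self abs_mult)
        also have "\<dots> \<le> \<bar>\<theta>\<bar> * \<epsilon>" using 1 by (intro mult_left_mono) (auto simp: abs_if)
        finally have "\<theta> * y \<le> \<theta> * x + \<bar>\<theta>\<bar> * \<epsilon>" by (simp add: algebra_simps)
        then have "exp (b n * \<theta> * y) \<le> c"
          unfolding c_def using elim(2) by (simp add: mult.assoc mult_left_mono)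
        moreover have "0 \<le> c1" "0 \<le> c2" by (auto simp: c1_def c2_def)
        ultimately show ?thesis using 1 by (simp add: add_increasing2)
      next
        case 2
        have "0 \<le> b n * s * (y - (x + \<epsilon>))" using 2 elim(2) s by simp
        then have "exp (b n * \<theta> * y) \<le> exp (b n * \<theta> * y + b n * s * (y - (x + \<epsilon>)))" by simp
        also have "\<dots> = c1 * exp (b n * (\<theta> + s) * y)"
          by (simp add: c1_def exp_add[symmetric] algebra_simps)
        finally show ?thesis by (auto simp: c_def c2_def indicator_def add_increasing add_increasing2)
      next
        case 3
        have "0 \<le> b n * s * (x - \<epsilon> - y)" using 3 elim(2) s by simp
        then have "exp (b n * \<theta> * y) \<le> exp (b n * \<theta> * y + b n * s * (x - \<epsilon> - y))" by simp
        also have "\<dots> = c2 * exp (b n * (\<theta> - s) * y)"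
          by (simp add: c2_def exp_add[symmetric] algebra_simps)
        finally show ?thesis by (auto simp: c_def c1_def indicator_def add_increasing)
      qed
    qed
    have int: "integrable (P n) (\<lambda>y. exp (b n * (\<theta> + s) * y))" "integrable (P n) (\<lambda>y. exp (b n * (\<theta> - s) * y))"
      "integrable (P n) (\<lambda>y. exp (b n * \<theta> * y))"
      "integrable (P n) (indicator ?B :: real \<Rightarrow> real)"
      using elim by (auto simp: emeasure_eq_measure)
    have "M \<theta> \<le> (\<integral>y. c * indicator ?B y + (c1 * exp (b n * (\<theta> + s) * y) + c2 * exp (b n * (\<theta> - s) * y)) \<partial>P n)"
      unfolding M_def using int pw by (intro integral_mono) auto
    also have "\<dots> = c * measure (P n) ?B + (c1 * M (\<theta> + s) + c2 * M (\<theta> - s))"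
      unfolding M_def using int by simp
    finally have main: "M \<theta> \<le> c * measure (P n) ?B + (c1 * M (\<theta> + s) + c2 * M (\<theta> - s))" .
    have small: "4 * exp (b n * (\<Lambda> \<theta> - s * \<epsilon> / 2 + \<eta>)) \<le> exp (b n * (\<Lambda> \<theta> - \<eta>))"
    proof -
      have "ln 4 / (s * \<epsilon> / 4) \<le> b n" using elim(1) by simp
      then have "ln 4 \<le> b n * (s * \<epsilon> / 4)"
        using \<open>s * \<epsilon> > 0\<close> by (subst (asm) pos_divide_le_eq) auto
      also have "\<dots> \<le> b n * (s * \<epsilon> / 2 - 2 * \<eta>)"
      proof (rule mult_left_mono)
        show "s * \<epsilon> / 4 \<le> s * \<epsilon> / 2 - 2 * \<eta>" using \<eta>(2) by linarith
      qed (use elim(2) in simp)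
      finally have "exp (ln 4) \<le> exp (b n * (s * \<epsilon> / 2 - 2 * \<eta>))" by (subst exp_le_cancel_iff)
      then have "4 * exp (b n * (\<Lambda> \<theta> - s * \<epsilon> / 2 + \<eta>)) \<le> exp (b n * (s * \<epsilon> / 2 - 2 * \<eta>)) * exp (b n * (\<Lambda> \<theta> - s * \<epsilon> / 2 + \<eta>))"
        by (intro mult_right_mono) auto
      also have "\<dots> = exp (b n * (\<Lambda> \<theta> - \<eta>))"
        by (simp add: exp_add[symmetric] algebra_simps)
      finally show ?thesis .
    qed
    have t1: "c1 * M (\<theta> + s) \<le> exp (b n * (\<Lambda> \<theta> - s * \<epsilon> / 2 + \<eta>))"
    proof -
      have "c1 * M (\<theta> + s) \<le> c1 * exp (b n * (\<Lambda> (\<theta> + s) + \<eta>))"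
        using elim(4) by (intro mult_left_mono) (auto simp: M_def c1_def)
      also have "\<dots> = exp (b n * (\<Lambda> (\<theta> + s) - s * (x + \<epsilon>) + \<eta>))"
        by (simp add: c1_def exp_add[symmetric] algebra_simps)
      also have "\<dots> \<le> exp (b n * (\<Lambda> \<theta> - s * \<epsilon> / 2 + \<eta>))"
        using up elim(2) by (auto intro!: mult_left_mono)
      finally show ?thesis .
    qed
    have t2: "c2 * M (\<theta> - s) \<le> exp (b n * (\<Lambda> \<theta> - s * \<epsilon> / 2 + \<eta>))"
    proof -
      have "c2 * M (\<theta> - s) \<le> c2 * exp (b n * (\<Lambda> (\<theta> - s) + \<eta>))"
        using elim(5) by (intro mult_left_mono) (auto simp: M_def c2_def)
      also have "\<dots> = exp (b n * (\<Lambda> (\<theta> - s) + s * (x - \<epsilon>) + \<eta>))"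
        by (simp add: c2_def exp_add[symmetric] algebra_simps)
      also have "\<dots> \<le> exp (b n * (\<Lambda> \<theta> - s * \<epsilon> / 2 + \<eta>))"
        using dn elim(2) by (auto intro!: mult_left_mono)
      finally show ?thesis .
    qed
    have "exp (b n * (\<Lambda> \<theta> - \<eta>)) \<le> M \<theta>" using elim(3) by (simp add: M_def)
    then have fin: "exp (b n * (\<Lambda> \<theta> - \<eta>)) \<le> 2 * c * measure (P n) ?B"
      using main small t1 t2 by linarith
    have "ln 2 / (\<epsilon> / 2) \<le> b n" using elim(1) by simp
    then have "ln 2 \<le> b n * (\<epsilon> / 2)"
      using \<open>\<epsilon> > 0\<close> by (subst (asm) pos_divide_le_eq) auto
    also have "\<dots> \<le> b n * (\<epsilon> - \<eta>)" using \<eta> elim(2) by (intro mult_left_mono) auto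
    finally have "exp (ln 2) \<le> exp (b n * (\<epsilon> - \<eta>))" by (subst exp_le_cancel_iff)
    then have "exp (- b n * (\<theta> * x - \<Lambda> \<theta> + \<bar>\<theta>\<bar> * \<epsilon> + \<epsilon>)) * (2 * c) \<le> 
       exp (- b n * (\<theta> * x - \<Lambda> \<theta> + \<bar>\<theta>\<bar> * \<epsilon> + \<epsilon>)) * (exp (b n * (\<epsilon> - \<eta>)) * c)"
      by (intro mult_left_mono mult_right_mono) (auto simp: c_def)
    also have "\<dots> = exp (b n * (\<Lambda> \<theta> - \<eta>))"
      by (simp add: c_def exp_add[symmetric] algebra_simps)
    also note fin
    finally have "exp (- b n * (\<theta> * x - \<Lambda> \<theta> + \<bar>\<theta>\<bar> * \<epsilon> + \<epsilon>)) * (2 * c) \<le> measure (P n) ?B * (2 * c)"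
      by (simp add: mult_ac)
    then show ?case by (rule mult_right_le_imp_le) (simp add: c_def)
  qed
qed

text \<open>Apply \<open>exposed_point_lower_bound\<close> at a derivative of \<open>\<Lambda>\<close> supplied by
  \<open>regularised_exposed_point\<close>, which lies close enough to \<open>x\<close> to be inside \<open>A\<close>.\<close>

lemma open_set_lower_bound:
  assumes diff: "\<And>\<theta>. \<Lambda> differentiable (at \<theta>)"
    and A: "A \<in> sets borel" "x \<in> interior A" and c: "legendre x < ereal c"
  shows "\<forall>\<^sub>F n in sequentially. exp (- b n * c) \<le> measure (P n) A"
proof -
  obtain J where J: "legendre x < ereal J" "J < c"
    using ereal_dense3[OF c] by auto
  have J': "\<theta> * x - \<Lambda> \<theta> \<le> J" for \<theta>
  proof -
    have "ereal (\<theta> * x - \<Lambda> \<theta>) \<le> legendre x" by (rule SUP_upper) simp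
    also note J(1)
    finally show ?thesis by simp
  qed
  obtain r where r: "r > 0" "ball x r \<subseteq> A"
    using A(2) by (auto simp: mem_interior)
  obtain \<theta> x' where x': "(\<Lambda> has_real_derivative x') (at \<theta>)" "\<bar>x' - x\<bar> < r / 2" "\<theta> * x' - \<Lambda> \<theta> \<le> J"
    using regularised_exposed_point[OF diff limit_at_0 J', of "r / 2"] r(1) by (metis half_gt_zero)
  define \<epsilon> where "\<epsilon> = min (r / 2) ((c - J) / (\<bar>\<theta>\<bar> + 1))"
  have \<epsilon>: "\<epsilon> > 0" "\<epsilon> \<le> r / 2" "\<epsilon> \<le> (c - J) / (\<bar>\<theta>\<bar> + 1)"
  proof -
    show "\<epsilon> > 0" using r(1) J(2) by (simp add: \<epsilon>_def)
  qed (unfold \<epsilon>_def, rule min.cobounded1, rule min.cobounded2)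
  have "\<bar>\<theta>\<bar> * \<epsilon> + \<epsilon> \<le> c - J" using \<epsilon>(3) by (simp add: field_simps)
  then have le: "\<theta> * x' - \<Lambda> \<theta> + \<bar>\<theta>\<bar> * \<epsilon> + \<epsilon> \<le> c" using x'(3) by linarith
  have sub: "{x' - \<epsilon><..<x' + \<epsilon>} \<subseteq> A"
  proof -
    have "{x' - \<epsilon><..<x' + \<epsilon>} \<subseteq> ball x r"
    proof
      fix y assume "y \<in> {x' - \<epsilon><..<x' + \<epsilon>}"
      then have "\<bar>x - y\<bar> < r" unfolding greaterThanLessThan_iff using x'(2) \<epsilon>(2) by linarith
      then show "y \<in> ball x r" by (simp add: dist_real_def)
    qed
    with r(2) show ?thesis by blast
  qed
  have "\<forall>\<^sub>F n in sequentially. b n > 0"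
    using speed by (simp add: filterlim_at_top_dense)
  with exposed_point_lower_bound[OF x'(1) \<epsilon>(1)] show ?thesis
  proof eventually_elim
    case (elim n)
    interpret prob_space "P n" by (rule prob)
    have "exp (- b n * c) \<le> exp (- b n * (\<theta> * x' - \<Lambda> \<theta> + \<bar>\<theta>\<bar> * \<epsilon> + \<epsilon>))"
      using le elim(2) by simp
    also have "\<dots> \<le> measure (P n) {x' - \<epsilon><..<x' + \<epsilon>}" by (rule elim(1))
    also have "\<dots> \<le> measure (P n) A" using sub A by (intro finite_measure_mono) auto
    finally show ?case .
  qed
qed

theorem gaertner_ellis:
  assumes diff: "\<And>\<theta>. \<Lambda> differentiable (at \<theta>)"
  shows "large_deviation_principle P b legendre"
  unfolding large_deviation_principle_def
proof (intro conjI allI ballI)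
  show "prob_space (P n)" "sets (P n) = sets borel" for n using prob by auto
  show "0 \<le> legendre x" for x
  proof -
    have "ereal (0 * x - \<Lambda> 0) \<le> legendre x" by (rule SUP_upper) simp
    then show ?thesis by (simp add: limit_at_0 zero_ereal_def)
  qed
  show "lower_semicontinuous legendre"
    unfolding lower_semicontinuous_def
  proof
    fix c
    have "{x. legendre x \<le> c} = (\<Inter>\<theta>. {x. ereal (\<theta> * x - \<Lambda> \<theta>) \<le> c})"
      by (auto simp: SUP_le_iff)
    also have "closed \<dots>"
      by (intro closed_INT ballI closed_Collect_le continuous_intros) 
    finally show "closed {x. legendre x \<le> c}" .
  qed
  have pos: "\<forall>\<^sub>F n in sequentially. b n > 0"
    using speed by (simp add: filterlim_at_top_dense)
  fix A :: "real set" assume A: "A \<in> sets borel"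
  let ?S = "\<lambda>n. ereal (1 / b n) * ext_ln (measure (P n) A)"
  show "liminf ?S \<le> limsup ?S" by (rule Liminf_le_Limsup) simp
  show "- (INF x\<in>interior A. legendre x) \<le> liminf ?S"
  proof (subst ereal_uminus_le_reorder, rule INF_greatest, subst ereal_uminus_le_reorder)
    fix x assume x: "x \<in> interior A"
    show "- legendre x \<le> liminf ?S"
      unfolding le_Liminf_iff
    proof (intro allI impI)
      fix y assume "y < - legendre x"
      then have "legendre x < - y" using ereal_less_uminus_reorder by blast
      then obtain c where c: "legendre x < ereal c" "ereal c < - y"
        using ereal_dense2 by blast
      from open_set_lower_bound[OF diff A x c(1)] pos
      show "\<forall>\<^sub>F n in sequentially. y < ?S n"
      proof eventually_elim
        case (elim n)
        have "measure (P n) A > 0" using elim(1) exp_gt_zero less_le_trans by blast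
        then have "- b n * c \<le> ln (measure (P n) A)"
          using elim(1) by (simp add: ln_ge_iff)
        then have "- c \<le> 1 / b n * ln (measure (P n) A)"
          using elim(2) by (simp add: field_simps)
        moreover have "y < ereal (- c)" using c(2) by (metis ereal_less_uminus_reorder uminus_ereal.simps(1))
        ultimately have "y < ereal (1 / b n * ln (measure (P n) A))"
          by (metis ereal_less_eq(3) less_le_trans)
        then show ?case using \<open>measure (P n) A > 0\<close> by (simp add: ext_ln_def)
      qed
    qed
  qed
  show "limsup ?S \<le> - (INF x\<in>closure A. legendre x)"
    unfolding Limsup_le_iff
  proof (intro allI impI)
    fix y assume "- (INF x\<in>closure A. legendre x) < y"
    then have "- y < (INF x\<in>closure A. legendre x)" by (simp add: ereal_uminus_less_reorder)
    then obtain r where r: "- y < ereal r" "ereal r < (INF x\<in>closure A. legendre x)"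
      using ereal_dense2 by blast
    have y: "ereal (- r) < y" using r(1) by (metis ereal_uminus_less_reorder uminus_ereal.simps(1))
    from closed_set_upper_bound[OF A r(2)] pos
    show "\<forall>\<^sub>F n in sequentially. ?S n < y"
    proof eventually_elim
      case (elim n)
      show ?case
      proof (cases "measure (P n) A > 0")
        case True
        then have "ln (measure (P n) A) \<le> - b n * r"
          using elim(1) exp_le_cancel_iff[of "ln (measure (P n) A)" "- b n * r"] by simp
        then have "1 / b n * ln (measure (P n) A) \<le> - r"
          using elim(2) by (simp add: field_simps)
        then have "ereal (1 / b n * ln (measure (P n) A)) < y"
          using y by (metis ereal_less_eq(3) le_less_trans)
        then show ?thesis using True by (simp add: ext_ln_def)
      next
        case False
        then show ?thesis using elim(2) y by (auto simp: ext_ln_def)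
      qed
    qed
  qed
qed

end

section \<open>Mean values of products over prime divisors\<close>

definition primes_upto :: "nat \<Rightarrow> nat set" where
  "primes_upto n = {p. prime p \<and> p \<le> n}"

lemma finite_primes_upto [simp]: "finite (primes_upto n)"
  by (rule finite_subset[of _ "{..n}"]) (auto simp: primes_upto_def)

lemma prime_primes_upto: "p \<in> primes_upto n \<Longrightarrow> prime p"
  by (simp add: primes_upto_def)

lemma prime_dvd_prod_primes_iff:
  fixes p :: nat
  assumes "finite T" "\<forall>q\<in>T. prime q" "prime p"
  shows "p dvd \<Prod>T \<longleftrightarrow> p \<in> T"
proof -
  have "p dvd \<Prod>T \<longleftrightarrow> (\<exists>q\<in>T. p dvd q)"
    using assms by (simp add: prime_dvd_prod_iff)
  also have "\<dots> \<longleftrightarrow> p \<in> T"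
    using assms(2,3) primes_dvd_imp_eq by (metis dvd_refl)
  finally show ?thesis .
qed

lemma prod_primes_dvd_iff:
  fixes T :: "nat set"
  assumes "finite T" "\<forall>p\<in>T. prime p"
  shows "\<Prod>T dvd m \<longleftrightarrow> (\<forall>p\<in>T. p dvd m)"
  using assms
proof (induction T rule: finite_induct)
  case (insert p T)
  have "coprime p (\<Prod>T)"
    using insert prime_dvd_prod_primes_iff[of T p] by (intro prime_imp_coprime) auto
  then show ?case using insert
    by (auto intro: divides_mult dest: dvd_mult_left dvd_mult_right)
qed simp

lemma inj_on_prod_primes: "inj_on (\<Prod>) {T. finite T \<and> (\<forall>p\<in>T. prime (p::nat))}"
proof (rule inj_onI)
  fix S T :: "nat set"
  assume "S \<in> {T. finite T \<and> (\<forall>p\<in>T. prime p)}" "T \<in> {T. finite T \<and> (\<forall>p\<in>T. prime p)}" "\<Prod>S = \<Prod>T"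
  then show "S = T" using prime_dvd_prod_primes_iff[of S] prime_dvd_prod_primes_iff[of T] by auto
qed

lemma card_multiples:
  assumes "d > (0::nat)"
  shows "card {m\<in>{1..n}. d dvd m} = n div d"
proof -
  have "{m\<in>{1..n}. d dvd m} = (\<lambda>j. d * j) ` {1..n div d}"
    using assms by (auto simp: div_le_mono image_iff less_eq_div_iff_mult_less_eq elim!: dvdE)
       (metis Suc_le_eq assms div_le_mono nat_0_less_mult_iff nonzero_mult_div_cancel_left not_gr_zero mult.commute)+
  moreover have "inj_on (\<lambda>j. d * j) {1..n div d}" using assms by (auto simp: inj_on_def)
  ultimately show ?thesis by (simp add: card_image)
qed

text \<open>Sets \<open>T\<close> of primes stand for the squarefree numbers \<open>\<Prod>T\<close>; the expansion is the convolution
  identity \<open>f = 1 * h\<close> for the multiplicative function with \<open>f (p ^ k) = 1 + h p\<close> on primes in \<open>Q\<close>, where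
  \<open>h\<close> is extended multiplicatively to the squarefree numbers and by \<open>0\<close> to all others.\<close>

lemma prod_one_plus_dvd_expand:
  fixes h :: "nat \<Rightarrow> real"
  assumes "finite Q" "\<forall>p\<in>Q. prime p"
  shows "(\<Prod>p\<in>Q. 1 + (if p dvd m then h p else 0)) = (\<Sum>T\<in>Pow Q. if \<Prod>T dvd m then prod h T else 0)"
proof -
  have "(\<Prod>p\<in>Q. (if p dvd m then h p else 0) + 1) = (\<Sum>T\<in>Pow Q. \<Prod>p\<in>T. if p dvd m then h p else 0)"
    using prod_add[OF assms(1), of "\<lambda>p. if p dvd m then h p else 0" "\<lambda>_. 1"] by simp
  also have "\<dots> = (\<Sum>T\<in>Pow Q. if \<Prod>T dvd m then prod h T else 0)"
  proof (rule sum.cong)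
    fix T assume "T \<in> Pow Q"
    then have T: "finite T" "\<forall>p\<in>T. prime p" using assms by (auto intro: finite_subset)
    show "(\<Prod>p\<in>T. if p dvd m then h p else 0) = (if \<Prod>T dvd m then prod h T else 0)"
      unfolding prod_primes_dvd_iff[OF T] using T(1) by (auto intro: prod.cong prod_zero)
  qed simp
  finally show ?thesis by (simp add: add.commute)
qed

lemma sum_prod_one_plus_dvd:
  fixes h :: "nat \<Rightarrow> real"
  assumes Q: "finite Q" "\<forall>p\<in>Q. prime p"
  shows "(\<Sum>m=1..n. \<Prod>p\<in>Q. 1 + (if p dvd m then h p else 0)) = (\<Sum>T\<in>Pow Q. prod h T * real (n div \<Prod>T))"
proof -
  have "(\<Sum>m=1..n. \<Prod>p\<in>Q. 1 + (if p dvd m then h p else 0)) = (\<Sum>m=1..n. \<Sum>T\<in>Pow Q. if \<Prod>T dvd m then prod h T else 0)"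
    by (simp only: prod_one_plus_dvd_expand[OF Q])
  also have "\<dots> = (\<Sum>T\<in>Pow Q. \<Sum>m=1..n. if \<Prod>T dvd m then prod h T else 0)" by (rule sum.swap)
  also have "\<dots> = (\<Sum>T\<in>Pow Q. prod h T * real (n div \<Prod>T))"
  proof (rule sum.cong)
    fix T assume "T \<in> Pow Q"
    then have T: "finite T" "\<forall>p\<in>T. prime p" using Q by (auto intro: finite_subset)
    then have "\<Prod>T > 0" by (intro prod_pos) (auto intro: prime_gt_0_nat)
    have "(\<Sum>m=1..n. if \<Prod>T dvd m then prod h T else 0) = (\<Sum>m\<in>{m\<in>{1..n}. \<Prod>T dvd m}. prod h T)"
      by (rule sum.inter_filter[symmetric]) simp
    also have "\<dots> = prod h T * real (n div \<Prod>T)"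
      using card_multiples[OF \<open>\<Prod>T > 0\<close>, of n] by simp
    finally show "(\<Sum>m=1..n. if \<Prod>T dvd m then prod h T else 0) = prod h T * real (n div \<Prod>T)" .
  qed simp
  finally show ?thesis .
qed

lemma prod_one_plus_expand:
  fixes h :: "nat \<Rightarrow> real"
  assumes "finite Q"
  shows "(\<Prod>p\<in>Q. 1 + h p / real p) = (\<Sum>T\<in>Pow Q. prod h T / real (\<Prod>T))"
  using prod_add[OF assms, of "\<lambda>p. h p / real p" "\<lambda>_. 1"] by (simp add: prod_dividef add.commute)

lemma powr_prod_nat:
  fixes T :: "nat set"
  shows "finite T \<Longrightarrow> real (\<Prod>T) powr s = (\<Prod>p\<in>T. real p powr s)"
  by (induction T rule: finite_induct) (auto simp: powr_mult prod_nonneg)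

text \<open>The difference is at most both \<open>1 / n\<close> and \<open>1 / d\<close>; Rankin's trick interpolates between the two
  bounds with exponents \<open>s\<close> and \<open>1 - s\<close>, which makes the bound multiplicative in \<open>d\<close>.\<close>

lemma div_approx:
  assumes "n > 0" "d > 0" "0 \<le> s" "s \<le> 1"
  shows "\<bar>real (n div d) / real n - 1 / real d\<bar> \<le> real n powr - s * (real d powr s / real d)"
proof -
  have eq: "real n powr - s * (real d powr s / real d) = (real d / real n) powr s / real d"
    using assms by (simp add: powr_divide powr_minus divide_simps)
  show ?thesis
  proof (cases "d \<le> n")
    case True
    have "\<bar>real (n div d) - real n / real d\<bar> \<le> 1"
      using of_nat_div_le_of_nat[of n d, where 'a = real] divide_nat_diff_div_nat_less_one[of n d] by linarith
    then have "\<bar>real (n div d) - real n / real d\<bar> / real n \<le> 1 / real n" by (rule divide_right_mono) simp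
    moreover have "real (n div d) / real n - 1 / real d = (real (n div d) - real n / real d) / real n"
      using assms by (simp add: field_simps)
    ultimately have "\<bar>real (n div d) / real n - 1 / real d\<bar> \<le> 1 / real n" by simp
    also have "\<dots> = (real d / real n) powr 1 / real d" using assms by simp
    also have "\<dots> \<le> (real d / real n) powr s / real d"
      using assms True by (intro divide_right_mono powr_mono') auto
    finally show ?thesis by (simp only: eq)
  next
    case False
    then have "\<bar>real (n div d) / real n - 1 / real d\<bar> = 1 / real d" by simp
    also have "\<dots> \<le> (real d / real n) powr s / real d"
      using False assms by (intro divide_right_mono ge_one_powr_ge_zero) auto
    finally show ?thesis by (simp only: eq)
  qed
qed

text \<open>Summing the bound of \<open>div_approx\<close> over all squarefree \<open>d\<close> composed of primes in \<open>Q\<close> gives an Euler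
  product again. For \<open>s\<close> of order \<open>1 / ln (Max Q)\<close> the factors \<open>p powr s\<close> are bounded, while
  \<open>n powr - s\<close> is a large saving if the primes in \<open>Q\<close> are small compared with \<open>n\<close>.\<close>

lemma mean_value_error:
  fixes h :: "nat \<Rightarrow> real"
  assumes Q: "finite Q" "\<forall>p\<in>Q. prime p" and n: "n > 0" and s: "0 \<le> s" "s \<le> 1"
  shows "\<bar>(\<Sum>m=1..n. \<Prod>p\<in>Q. 1 + (if p dvd m then h p else 0)) / real n - (\<Prod>p\<in>Q. 1 + h p / real p)\<bar>
    \<le> real n powr - s * (\<Prod>p\<in>Q. 1 + \<bar>h p\<bar> * real p powr s / real p)"
proof -
  have pos: "\<Prod>T > 0" if "T \<in> Pow Q" for T
    using that Q by (intro prod_pos) (auto intro: prime_gt_0_nat)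
  have "(\<Sum>m=1..n. \<Prod>p\<in>Q. 1 + (if p dvd m then h p else 0)) / real n - (\<Prod>p\<in>Q. 1 + h p / real p)
     = (\<Sum>T\<in>Pow Q. prod h T * (real (n div \<Prod>T) / real n - 1 / real (\<Prod>T)))"
    unfolding sum_prod_one_plus_dvd[OF Q] prod_one_plus_expand[OF Q(1)]
    by (simp add: sum_divide_distrib sum_subtractf right_diff_distrib)
  also have "\<bar>\<dots>\<bar> \<le> (\<Sum>T\<in>Pow Q. \<bar>prod h T * (real (n div \<Prod>T) / real n - 1 / real (\<Prod>T))\<bar>)"
    by (rule sum_abs)
  also have "\<dots> \<le> (\<Sum>T\<in>Pow Q. \<bar>prod h T\<bar> * (real n powr - s * (real (\<Prod>T) powr s / real (\<Prod>T))))"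
    unfolding abs_mult using pos n s by (intro sum_mono mult_left_mono div_approx) auto
  also have "\<dots> = real n powr - s * (\<Sum>T\<in>Pow Q. (\<Prod>p\<in>T. \<bar>h p\<bar> * real p powr s) / real (\<Prod>T))"
    unfolding sum_distrib_left
  proof (rule sum.cong)
    fix T assume "T \<in> Pow Q"
    then have "finite T" using Q by (auto intro: finite_subset)
    then show "\<bar>prod h T\<bar> * (real n powr - s * (real (\<Prod>T) powr s / real (\<Prod>T))) = real n powr - s * ((\<Prod>p\<in>T. \<bar>h p\<bar> * real p powr s) / real (\<Prod>T))"
      by (simp only: powr_prod_nat prod.distrib abs_prod) (simp add: mult_ac)
  qed simp
  finally show ?thesis by (simp only: prod_one_plus_expand[OF Q(1)])
qed

text \<open>For nonnegative \<open>h\<close> all terms of the expansion are nonnegative and \<open>n div d \<le> n / d\<close>, so that no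
  restriction on the size of the primes is necessary.\<close>

lemma mean_value_upper_bound:
  fixes h :: "nat \<Rightarrow> real"
  assumes Q: "finite Q" "\<forall>p\<in>Q. prime p" and n: "n > 0" and h: "\<And>p. p \<in> Q \<Longrightarrow> 0 \<le> h p"
  shows "(\<Sum>m=1..n. \<Prod>p\<in>Q. 1 + (if p dvd m then h p else 0)) / real n \<le> exp (\<Sum>p\<in>Q. h p / real p)"
proof -
  have "(\<Sum>m=1..n. \<Prod>p\<in>Q. 1 + (if p dvd m then h p else 0)) / real n
      = (\<Sum>T\<in>Pow Q. prod h T * (real (n div \<Prod>T) / real n))"
    unfolding sum_prod_one_plus_dvd[OF Q] by (simp add: sum_divide_distrib)
  also have "\<dots> \<le> (\<Sum>T\<in>Pow Q. prod h T * (1 / real (\<Prod>T)))"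
  proof (intro sum_mono mult_left_mono)
    fix T assume "T \<in> Pow Q"
    show "real (n div \<Prod>T) / real n \<le> 1 / real (\<Prod>T)"
      using n of_nat_div_le_of_nat[where 'a = real, of n "\<Prod>T"] by (simp add: field_simps)
    show "0 \<le> prod h T" using \<open>T \<in> Pow Q\<close> h by (intro prod_nonneg) auto
  qed
  also have "\<dots> = (\<Prod>p\<in>Q. 1 + h p / real p)" by (simp add: prod_one_plus_expand[OF Q(1)])
  also have "\<dots> \<le> (\<Prod>p\<in>Q. exp (h p / real p))"
    using h by (intro prod_mono) (auto simp: exp_ge_add_one_self add_nonneg_nonneg)
  also have "\<dots> = exp (\<Sum>p\<in>Q. h p / real p)" by (rule exp_sum[OF Q(1), symmetric])
  finally show ?thesis .
qed

section \<open>The sum of the reciprocals of the primes\<close>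

lemma sum_inverse_squares_le: "(\<Sum>k=1..n. 1 / real k ^ 2) \<le> 2"
proof -
  have "(\<Sum>k=1..n. 1 / real k ^ 2) \<le> 2 - 1 / real n" if "n \<ge> 1"
    using that
  proof (induction n rule: dec_induct)
    case (step n)
    have "1 / real (Suc n) ^ 2 \<le> 1 / real n - 1 / real (Suc n)"
    proof -
      have "1 / real (Suc n) ^ 2 \<le> 1 / (real n * real (Suc n))"
        using step by (intro divide_left_mono) (auto simp: power2_eq_square mult_right_mono)
      also have "\<dots> = 1 / real n - 1 / real (Suc n)" using step by (simp add: field_simps)
      finally show ?thesis .
    qed
    then show ?case using step by simp
  qed simp
  then show ?thesis by (cases "n \<ge> 1") (auto intro: order_trans)
qed

text \<open>A bound for the partial sums of \<open>\<zeta>(1 + \<epsilon>)\<close>, by telescoping \<open>k powr - \<epsilon> / \<epsilon>\<close>.\<close>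

lemma sum_powr_le:
  assumes "\<epsilon> > 0"
  shows "(\<Sum>k=1..n. real k powr - (1 + \<epsilon>)) \<le> 1 + 1 / \<epsilon>"
proof -
  have "(\<Sum>k=1..n. real k powr - (1 + \<epsilon>)) \<le> 1 + (1 - real n powr - \<epsilon>) / \<epsilon>" if "n \<ge> 1"
    using that
  proof (induction n rule: dec_induct)
    case base show ?case using assms by simp
  next
    case (step n)
    have "1 + \<epsilon> / real (Suc n) \<le> exp (\<epsilon> / real (Suc n))" by (rule exp_ge_add_one_self)
    also have "\<dots> \<le> exp (- \<epsilon> * ln (real n / real (Suc n)))"
    proof -
      have "ln (real n / real (Suc n)) \<le> real n / real (Suc n) - 1"
        using step by (intro ln_le_minus_one) auto
      also have "\<dots> = - 1 / real (Suc n)" by (simp add: field_simps)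
      finally show ?thesis using assms mult_left_mono[of "ln (real n / real (Suc n))" "- 1 / real (Suc n)" \<epsilon>] by simp
    qed
    also have "\<dots> = real n powr - \<epsilon> / real (Suc n) powr - \<epsilon>"
      using step by (simp add: powr_def ln_div exp_diff[symmetric] algebra_simps)
    finally have "real (Suc n) powr - \<epsilon> * (1 + \<epsilon> / real (Suc n)) \<le> real n powr - \<epsilon>"
      by (simp add: field_simps)
    moreover have "real (Suc n) powr - (1 + \<epsilon>) = real (Suc n) powr - \<epsilon> / real (Suc n)"
    proof -
      have "- (1 + \<epsilon>) = - \<epsilon> - 1" by simp
      then show ?thesis by (simp only: powr_diff) simp
    qed
    ultimately have "\<epsilon> * real (Suc n) powr - (1 + \<epsilon>) \<le> real n powr - \<epsilon> - real (Suc n) powr - \<epsilon>"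
      by (simp add: algebra_simps)
    then have "real (Suc n) powr - (1 + \<epsilon>) \<le> (real n powr - \<epsilon> - real (Suc n) powr - \<epsilon>) / \<epsilon>"
      using assms by (simp add: field_simps)
    then show ?case using step by (simp add: diff_divide_distrib)
  qed
  moreover have "(1 - real n powr - \<epsilon>) / \<epsilon> \<le> 1 / \<epsilon>" using assms by (simp add: divide_right_mono)
  ultimately show ?thesis using assms by (cases "n \<ge> 1") (auto intro: order_trans)
qed

text \<open>Every \<open>m \<le> n\<close> is a squarefree number with prime factors up to \<open>n\<close> times a square, so the harmonic
  sum, which is at least \<open>ln n\<close>, is at most the product of \<open>1 + 1 / p\<close> times a bounded factor.\<close>

lemma sum_inverse_primes_ge:
  assumes "n \<ge> 2"
  shows "ln (ln (real n)) - ln 2 \<le> (\<Sum>p\<in>primes_upto n. 1 / real p)"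
proof -
  let ?P = "primes_upto n"
  have "ln (real n) \<le> ln (real n + 1)" using assms by simp
  also have "\<dots> \<le> harm n" by (rule ln_le_harm)
  also have "\<dots> = (\<Sum>m=1..n. 1 / real m)" by (simp add: harm_def inverse_eq_divide)
  also have "\<dots> \<le> (\<Sum>m\<in>(\<lambda>(T, k). \<Prod>T * k ^ 2) ` (Pow ?P \<times> {1..n}). 1 / real m)"
  proof (rule sum_mono2)
    show "{1..n} \<subseteq> (\<lambda>(T, k). \<Prod>T * k ^ 2) ` (Pow ?P \<times> {1..n})"
    proof
      fix m assume m: "m \<in> {1..n}"
      define d where "d = squarefree_part m"
      define k where "k = square_part m"
      have dk: "m = d * k ^ 2" unfolding d_def k_def by (rule squarefree_decompose)
      have "d > 0" "k > 0" using m dk by (auto intro: Nat.gr0I)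
      have "d dvd m" "k dvd m" using dk by (auto simp: power2_eq_square)
      then have le: "d \<le> n" "k \<le> n" using m by (auto dest!: dvd_imp_le)
      have "squarefree d" by (simp add: d_def)
      then have "\<forall>p\<in>prime_factors d. multiplicity p d = 1"
        using \<open>d > 0\<close> by (subst (asm) squarefree_factorial_semiring') auto
      then have "(\<Prod>p\<in>prime_factors d. p ^ multiplicity p d) = \<Prod>(prime_factors d)"
        by (intro prod.cong) auto
      then have "\<Prod>(prime_factors d) = d"
        using prime_factorization_nat[OF \<open>d > 0\<close>] by simp
      moreover have "prime_factors d \<subseteq> ?P"
        using le \<open>d > 0\<close> by (auto simp: primes_upto_def prime_factors_dvd dest: dvd_imp_le)
      ultimately show "m \<in> (\<lambda>(T, k). \<Prod>T * k ^ 2) ` (Pow ?P \<times> {1..n})"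
        using dk le \<open>k > 0\<close> by (intro image_eqI[of _ _ "(prime_factors d, k)"]) auto
    qed
  qed auto
  also have "\<dots> \<le> (\<Sum>x\<in>Pow ?P \<times> {1..n}. 1 / real ((\<lambda>(T, k). \<Prod>T * k ^ 2) x))"
    using sum_image_le[of "Pow ?P \<times> {1..n}" "\<lambda>m. 1 / real m" "\<lambda>(T, k). \<Prod>T * k ^ 2"]
    by (simp only: o_def) (simp add: finite_cartesian_product)
  also have "\<dots> = (\<Sum>T\<in>Pow ?P. 1 / real (\<Prod>T)) * (\<Sum>k=1..n. 1 / real k ^ 2)"
    unfolding sum_product sum.cartesian_product by (intro sum.cong) auto
  also have "(\<Sum>T\<in>Pow ?P. 1 / real (\<Prod>T)) = (\<Prod>p\<in>?P. 1 + 1 / real p)"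
    using prod_one_plus_expand[of ?P "\<lambda>_. 1"] by simp
  also have "\<dots> * (\<Sum>k=1..n. 1 / real k ^ 2) \<le> (\<Prod>p\<in>?P. exp (1 / real p)) * 2"
    by (intro mult_mono prod_mono sum_inverse_squares_le prod_nonneg sum_nonneg)
       (auto simp: exp_ge_add_one_self add_nonneg_nonneg)
  also have "(\<Prod>p\<in>?P. exp (1 / real p)) = exp (\<Sum>p\<in>?P. 1 / real p)" by (simp add: exp_sum)
  finally have "ln (ln (real n)) \<le> ln (exp (\<Sum>p\<in>?P. 1 / real p) * 2)"
    using assms by (intro ln_mono) auto
  also have "\<dots> = (\<Sum>p\<in>?P. 1 / real p) + ln 2" by (simp add: ln_mult)
  finally show ?thesis by simp
qed

text \<open>Comparing the Euler product of \<open>1 + p powr - (1 + \<epsilon>)\<close> with \<open>\<zeta>(1 + \<epsilon>)\<close> bounds the sum of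
  \<open>p powr - (1 + \<epsilon>)\<close> over the primes by \<open>ln (1 + 1 / \<epsilon>) + 2\<close>; removing the \<open>\<epsilon>\<close> from the exponent costs
  the factor \<open>n powr \<epsilon>\<close>.\<close>

lemma sum_inverse_primes_le:
  assumes "\<epsilon> > 0" "n \<ge> 1"
  shows "(\<Sum>p\<in>primes_upto n. 1 / real p) \<le> real n powr \<epsilon> * (ln (1 + 1 / \<epsilon>) + 2)"
proof -
  let ?P = "primes_upto n"
  define f where "f = (\<lambda>p::nat. real p powr - (1 + \<epsilon>))"
  have prime_ge: "real p \<ge> 2" if "p \<in> ?P" for p
    using that prime_ge_2_nat[of p] by (auto simp: primes_upto_def)
  have f_le: "f p \<le> 1 / real p" if "p \<in> ?P" for p
  proof -
    have "f p \<le> real p powr - 1" unfolding f_def using prime_ge[OF that] assms by (intro powr_mono) auto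
    then show ?thesis using prime_ge[OF that] by (simp add: powr_minus inverse_eq_divide)
  qed
  have f_nonneg: "0 \<le> f p" for p by (simp add: f_def)
  have "exp (\<Sum>p\<in>?P. f p - (f p)\<^sup>2) = (\<Prod>p\<in>?P. exp (f p - (f p)\<^sup>2))" by (simp add: exp_sum)
  also have "\<dots> \<le> (\<Prod>p\<in>?P. 1 + f p)"
  proof (intro prod_mono conjI)
    fix p assume p: "p \<in> ?P"
    have "1 / real p \<le> 1" using prime_ge[OF p] by simp
    then have "f p \<le> 1" using f_le[OF p] by linarith
    then have "f p - (f p)\<^sup>2 \<le> ln (1 + f p)" using f_nonneg by (intro ln_one_plus_pos_lower_bound)
    then show "exp (f p - (f p)\<^sup>2) \<le> 1 + f p"
      using f_nonneg[of p] by (subst (asm) ln_ge_iff) auto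
  qed simp
  also have "\<dots> = (\<Sum>T\<in>Pow ?P. real (\<Prod>T) powr - (1 + \<epsilon>))"
  proof -
    have "(\<Prod>p\<in>?P. f p + 1) = (\<Sum>T\<in>Pow ?P. prod f T)"
      using prod_add[of ?P f "\<lambda>_. 1"] by simp
    also have "\<dots> = (\<Sum>T\<in>Pow ?P. real (\<Prod>T) powr - (1 + \<epsilon>))"
      by (intro sum.cong refl, subst powr_prod_nat) (auto simp: f_def intro: finite_subset[OF _ finite_primes_upto[of n]])
    finally show ?thesis by (simp add: add.commute)
  qed
  also have "\<dots> = (\<Sum>m\<in>(\<Prod>) ` Pow ?P. real m powr - (1 + \<epsilon>))"
  proof -
    have "inj_on (\<Prod>) (Pow ?P)"
      by (rule inj_on_subset[OF inj_on_prod_primes]) (auto dest: prime_primes_upto intro: finite_subset[OF _ finite_primes_upto[of n]])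
    then show ?thesis by (simp add: sum.reindex)
  qed
  also have "\<dots> \<le> (\<Sum>m=1..Max ((\<Prod>) ` Pow ?P). real m powr - (1 + \<epsilon>))"
  proof (rule sum_mono2)
    show "(\<Prod>) ` Pow ?P \<subseteq> {1..Max ((\<Prod>) ` Pow ?P)}"
    proof
      fix m assume m: "m \<in> (\<Prod>) ` Pow ?P"
      then obtain T where "m = \<Prod>T" "T \<subseteq> ?P" by auto
      then have "m > 0"
        unfolding \<open>m = \<Prod>T\<close> by (intro prod_pos) (auto dest: prime_primes_upto prime_gt_0_nat)
      moreover have "m \<le> Max ((\<Prod>) ` Pow ?P)" using m by (intro Max_ge) auto
      ultimately show "m \<in> {1..Max ((\<Prod>) ` Pow ?P)}" by simp
    qed
  qed auto
  also have "\<dots> \<le> 1 + 1 / \<epsilon>" by (rule sum_powr_le) fact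
  finally have "(\<Sum>p\<in>?P. f p - (f p)\<^sup>2) \<le> ln (1 + 1 / \<epsilon>)"
    using assms by (subst ln_ge_iff) (auto intro: add_pos_pos)
  then have "(\<Sum>p\<in>?P. f p) \<le> ln (1 + 1 / \<epsilon>) + (\<Sum>p\<in>?P. (f p)\<^sup>2)"
    by (simp add: sum_subtractf)
  also have "(\<Sum>p\<in>?P. (f p)\<^sup>2) \<le> (\<Sum>p\<in>?P. 1 / real p ^ 2)"
  proof (rule sum_mono)
    fix p assume "p \<in> ?P"
    then have "(f p)\<^sup>2 \<le> (1 / real p)\<^sup>2" using f_le f_nonneg by (intro power_mono) auto
    then show "(f p)\<^sup>2 \<le> 1 / real p ^ 2" by (simp add: power_divide)
  qed
  also have "\<dots> \<le> (\<Sum>k=1..n. 1 / real k ^ 2)"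
    by (intro sum_mono2) (auto simp: primes_upto_def Suc_le_eq prime_gt_0_nat)
  also have "\<dots> \<le> 2" by (rule sum_inverse_squares_le)
  finally have sum_f: "(\<Sum>p\<in>?P. f p) \<le> ln (1 + 1 / \<epsilon>) + 2" by simp
  have "(\<Sum>p\<in>?P. 1 / real p) \<le> (\<Sum>p\<in>?P. real n powr \<epsilon> * f p)"
  proof (rule sum_mono)
    fix p assume p: "p \<in> ?P"
    have "1 / real p = real p powr \<epsilon> * f p"
      using prime_ge[OF p] by (simp add: f_def powr_add[symmetric] powr_minus inverse_eq_divide)
    also have "\<dots> \<le> real n powr \<epsilon> * f p"
      using p assms f_nonneg by (intro mult_right_mono powr_mono2) (auto simp: primes_upto_def)
    finally show "1 / real p \<le> real n powr \<epsilon> * f p" .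
  qed
  also have "\<dots> = real n powr \<epsilon> * (\<Sum>p\<in>?P. f p)" by (simp add: sum_distrib_left)
  also have "\<dots> \<le> real n powr \<epsilon> * (ln (1 + 1 / \<epsilon>) + 2)" using sum_f by (intro mult_left_mono) auto
  finally show ?thesis .
qed

text \<open>The upper bound uses \<open>sum_inverse_primes_le\<close> with \<open>\<epsilon> = 1 / (ln n * ln (ln n))\<close>: then
  \<open>n powr \<epsilon>\<close> tends to \<open>1\<close>, yet \<open>ln (1 / \<epsilon>)\<close> is still asymptotic to \<open>ln (ln n)\<close>. This is weaker than
  Mertens' second theorem, but the leading order is what the scale of the large deviation principle
  sees.\<close>

theorem sum_inverse_primes_asymp:
  "(\<lambda>n. (\<Sum>p\<in>primes_upto n. 1 / real p) / ln (ln (real n))) \<longlonglongrightarrow> 1"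
proof (rule tendsto_sandwich)
  have pos: "\<forall>\<^sub>F n in sequentially. ln (ln (real n)) > 0" by real_asymp
  show "\<forall>\<^sub>F n in sequentially. (ln (ln (real n)) - ln 2) / ln (ln (real n)) \<le> (\<Sum>p\<in>primes_upto n. 1 / real p) / ln (ln (real n))"
    using pos eventually_ge_at_top[of 2]
    by eventually_elim (intro divide_right_mono sum_inverse_primes_ge, auto)
  show "(\<lambda>n. (ln (ln (real n)) - ln 2) / ln (ln (real n))) \<longlonglongrightarrow> 1" by real_asymp
  show "(\<lambda>n. exp (1 / ln (ln (real n))) * (ln (1 + ln (real n) * ln (ln (real n))) + 2) / ln (ln (real n))) \<longlonglongrightarrow> 1"
    by real_asymp
  have "\<forall>\<^sub>F n in sequentially. ln (real n) > 0" by real_asymp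
  with pos show "\<forall>\<^sub>F n in sequentially. (\<Sum>p\<in>primes_upto n. 1 / real p) / ln (ln (real n))
      \<le> exp (1 / ln (ln (real n))) * (ln (1 + ln (real n) * ln (ln (real n))) + 2) / ln (ln (real n))"
    using eventually_ge_at_top[of 2]
  proof eventually_elim
    case (elim n)
    define \<epsilon> where "\<epsilon> = 1 / (ln (real n) * ln (ln (real n)))"
    have "\<epsilon> > 0" using elim by (simp add: \<epsilon>_def)
    have "real n powr \<epsilon> = exp (1 / ln (ln (real n)))" using elim by (simp add: powr_def \<epsilon>_def)
    moreover have "1 / \<epsilon> = ln (real n) * ln (ln (real n))" by (simp add: \<epsilon>_def)
    ultimately show ?case
      using sum_inverse_primes_le[OF \<open>\<epsilon> > 0\<close>, of n] elim by (intro divide_right_mono) auto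
  qed
qed

section \<open>Strongly additive functions as sums over prime divisors\<close>

definition additive_part :: "(nat \<Rightarrow> real) \<Rightarrow> nat set \<Rightarrow> nat \<Rightarrow> real" where
  "additive_part g Q m = (\<Sum>p\<in>Q. if p dvd m then g p else 0)"

lemma exp_additive_part:
  assumes "finite Q"
  shows "exp (\<theta> * additive_part g Q m) = (\<Prod>p\<in>Q. 1 + (if p dvd m then exp (\<theta> * g p) - 1 else 0))"
  using assms by (auto simp: additive_part_def sum_distrib_left exp_sum intro!: prod.cong)

lemma strongly_additive_sum_prime_divisors:
  assumes g: "strongly_additive g" and "m > 0"
  shows "g m = (\<Sum>p | prime p \<and> p dvd m. g p)"
  using \<open>m > 0\<close>
proof (induction m rule: less_induct)
  case (less m)
  have mult: "g (a * b) = g a + g b" if "a \<ge> 1" "b \<ge> 1" "coprime a b" for a b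
    using g that by (auto simp: strongly_additive_def)
  show ?case
  proof (cases "m = 1")
    case True
    have "{p::nat. prime p \<and> p dvd 1} = {}" using not_prime_unit by blast
    moreover have "g 1 = 0" using mult[of 1 1] by simp
    ultimately show ?thesis by (simp only: True sum.empty)
  next
    case False
    then obtain p where p: "prime p" "p dvd m" using prime_factor_nat by blast
    define k where "k = multiplicity p m"
    have "m \<noteq> 0" "\<not> is_unit p" using less.prems p by (auto dest: not_prime_unit)
    then obtain r where r: "m = p ^ k * r" "\<not> p dvd r"
      using multiplicity_decompose'[of m p] unfolding k_def by blast
    have "k \<ge> 1" using r p by (cases k) auto
    have "r > 0" using r \<open>m \<noteq> 0\<close> by (auto intro: Nat.gr0I)
    have cop: "coprime (p ^ k) r" using p r by (simp add: prime_imp_coprime)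
    have "p ^ k > 1" using \<open>k \<ge> 1\<close> prime_gt_1_nat[OF p(1)] by (intro one_less_power) auto
    then have "r < m" using r \<open>r > 0\<close> by simp
    have "{q. prime q \<and> q dvd m} = insert p {q. prime q \<and> q dvd r}"
    proof -
      have "q dvd m \<longleftrightarrow> q = p \<or> q dvd r" if "prime q" for q
      proof -
        have "q dvd p ^ k \<longleftrightarrow> q dvd p"
          using that \<open>k \<ge> 1\<close> by (simp add: prime_dvd_power_iff)
        also have "\<dots> \<longleftrightarrow> q = p" using that p(1) by (auto intro: primes_dvd_imp_eq)
        finally show ?thesis using that r(1) by (simp add: prime_dvd_mult_iff)
      qed
      then show ?thesis using p(1) by auto
    qed
    moreover have "finite {q. prime q \<and> q dvd r}"
      by (rule finite_subset[of _ "{..r}"]) (use \<open>r > 0\<close> in \<open>auto dest: dvd_imp_le\<close>)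
    moreover have "g m = g p + g r"
      using mult[OF _ _ cop] g p \<open>k \<ge> 1\<close> \<open>p ^ k > 1\<close> \<open>r > 0\<close> r(1) by (simp add: strongly_additive_def)
    ultimately show ?thesis using less.IH[OF \<open>r < m\<close> \<open>r > 0\<close>] r(2) by simp
  qed
qed

lemma strongly_additive_eq_additive_part:
  assumes "strongly_additive g" "m \<in> {1..n}"
  shows "g m = additive_part g (primes_upto n) m"
proof -
  have "{p. prime p \<and> p dvd m} = {p \<in> primes_upto n. p dvd m}"
    using assms(2) by (auto simp: primes_upto_def dest: dvd_imp_le)
  then have "g m = (\<Sum>p\<in>{p \<in> primes_upto n. p dvd m}. g p)"
    using strongly_additive_sum_prime_divisors[of g m] assms by simp
  then show ?thesis by (simp add: additive_part_def sum.inter_filter)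
qed

lemma additive_part_split:
  assumes "finite Q" "P \<subseteq> Q"
  shows "additive_part g Q m = additive_part g P m + additive_part g (Q - P) m"
  using sum.subset_diff[OF assms(2,1), of "\<lambda>p. if p dvd m then g p else 0"]
  by (simp add: additive_part_def add.commute)

definition log_mean_exp :: "nat \<Rightarrow> (nat \<Rightarrow> real) \<Rightarrow> real" where
  "log_mean_exp n f = ln ((\<Sum>m=1..n. exp (f m)) / real n)"

lemma sum_exp_pos: "n > 0 \<Longrightarrow> (\<Sum>m=1..n::nat. exp (f m :: real)) > 0"
  by (rule sum_pos) auto

text \<open>Hoelder's inequality with exponents \<open>1 / (1 - t)\<close> and \<open>1 / t\<close>, in logarithmic form. After both
  families are normalised to mean \<open>1\<close> it is the convexity of \<open>exp\<close>.\<close>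

lemma log_mean_exp_convex:
  assumes n: "n > 0" and t: "0 \<le> t" "t \<le> 1"
  shows "log_mean_exp n (\<lambda>m. (1 - t) * a m + t * b m) \<le> (1 - t) * log_mean_exp n a + t * log_mean_exp n b"
proof -
  define \<alpha> where "\<alpha> = log_mean_exp n a"
  define \<beta> where "\<beta> = log_mean_exp n b"
  have norm: "(\<Sum>m=1..n. exp (f m - log_mean_exp n f)) = real n" for f
  proof -
    have "exp (log_mean_exp n f) = (\<Sum>m=1..n. exp (f m)) / real n"
      using sum_exp_pos[OF n, of f] n by (simp add: log_mean_exp_def)
    moreover have "(\<Sum>m=1..n. exp (f m - log_mean_exp n f)) = (\<Sum>m=1..n. exp (f m)) / exp (log_mean_exp n f)"
      by (simp add: exp_diff sum_divide_distrib)
    ultimately show ?thesis using sum_exp_pos[OF n, of f] by simp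
  qed
  have "(\<Sum>m=1..n. exp ((1 - t) * a m + t * b m)) / exp ((1 - t) * \<alpha> + t * \<beta>)
      = (\<Sum>m=1..n. exp ((1 - t) * (a m - \<alpha>) + t * (b m - \<beta>)))"
    by (simp add: sum_divide_distrib exp_diff[symmetric] algebra_simps)
  also have "\<dots> \<le> (\<Sum>m=1..n. (1 - t) * exp (a m - \<alpha>) + t * exp (b m - \<beta>))"
    using convex_onD[OF exp_convex, of t] t by (intro sum_mono) auto
  also have "\<dots> = real n"
    unfolding sum.distrib sum_distrib_left[symmetric] \<alpha>_def \<beta>_def norm by (simp add: algebra_simps)
  finally have "(\<Sum>m=1..n. exp ((1 - t) * a m + t * b m)) / real n \<le> exp ((1 - t) * \<alpha> + t * \<beta>)"
    using n by (simp add: field_simps)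
  then have "log_mean_exp n (\<lambda>m. (1 - t) * a m + t * b m) \<le> ln (exp ((1 - t) * \<alpha> + t * \<beta>))"
    unfolding log_mean_exp_def using sum_exp_pos[OF n] n by (intro ln_mono) auto
  then show ?thesis by (simp add: \<alpha>_def \<beta>_def)
qed

lemma ln_one_plus_lower_bound:
  fixes x :: real
  assumes "- 1 / 2 \<le> x"
  shows "x - 2 * x\<^sup>2 \<le> ln (1 + x)"
proof -
  consider "x < 0" | "0 \<le> x" "x \<le> 1" | "x > 1" by linarith
  then show ?thesis
  proof cases
    case 1
    then show ?thesis using ln_one_minus_pos_lower_bound[of "- x"] assms by simp
  next
    case 2
    then have "x - x\<^sup>2 \<le> ln (1 + x)" by (intro ln_one_plus_pos_lower_bound)
    then show ?thesis by (smt (verit) zero_le_power2)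
  next
    case 3
    then have "x * 1 \<le> x * x" by (intro mult_left_mono) auto
    then have "x - 2 * x\<^sup>2 \<le> 0" using 3 by (simp add: power2_eq_square)
    also have "0 \<le> ln (1 + x)" using 3 by simp
    finally show ?thesis .
  qed
qed

section \<open>The logarithmic moment generating function\<close>

text \<open>The exponent is a compromise: \<open>1 / L\<^sup>2\<close> with \<open>L = ln (ln n)\<close> is small enough for Rankin's trick
  to save \<open>exp (- L\<^sup>2)\<close>, more than any fixed power of \<open>exp L\<close>, and large enough for
  \<open>ln (ln (cutoff n))\<close> to remain asymptotic to \<open>L\<close>.\<close>

definition cutoff :: "nat \<Rightarrow> nat" where
  "cutoff n = nat \<lfloor>real n powr (1 / (ln (ln (real n)))\<^sup>2)\<rfloor>"

lemma filterlim_cutoff: "filterlim cutoff at_top sequentially"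
  unfolding cutoff_def by real_asymp

lemma ln_ln_cutoff: "(\<lambda>n. ln (ln (real (cutoff n))) / ln (ln (real n))) \<longlonglongrightarrow> 1"
  unfolding cutoff_def by real_asymp

lemma cutoff_le: "\<forall>\<^sub>F n in sequentially. cutoff n \<le> n"
proof -
  have "\<forall>\<^sub>F n in sequentially. real (cutoff n) < real n"
    unfolding cutoff_def by real_asymp
  then show ?thesis by eventually_elim simp
qed

text \<open>The hypothesis on the laws \<open>prime_law g n\<close> with the normalising sum of \<open>1 / p\<close> replaced by its
  leading term. It does not bound \<open>g\<close> on the primes, so the arguments below control the function
  only through these sums.\<close>

locale prime_moments =
  fixes g :: "nat \<Rightarrow> real" and M :: "real \<Rightarrow> real"
  assumes prime_sum: "\<And>\<theta>. (\<lambda>n. (\<Sum>p\<in>primes_upto n. exp (\<theta> * g p) / real p) / ln (ln (real n))) \<longlonglongrightarrow> M \<theta>"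
begin

definition S :: "real \<Rightarrow> nat \<Rightarrow> real" where
  "S \<theta> n = (\<Sum>p\<in>primes_upto n. exp (\<theta> * g p) / real p)"

definition S2 :: "real \<Rightarrow> nat \<Rightarrow> real" where
  "S2 \<theta> n = (\<Sum>p\<in>primes_upto n. exp (\<theta> * g p) / real p ^ 2)"

lemma S_lim: "(\<lambda>n. S \<theta> n / ln (ln (real n))) \<longlonglongrightarrow> M \<theta>"
  using prime_sum by (simp add: S_def)

lemma M_0: "M 0 = 1"
  using LIMSEQ_unique[OF S_lim[of 0]] sum_inverse_primes_asymp by (simp add: S_def)

text \<open>Truncation at \<open>cutoff n\<close> is invisible to leading order, so the primes between \<open>cutoff n\<close> and \<open>n\<close>
  contribute \<open>o(ln (ln n))\<close>.\<close>

lemma at_cutoff: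
  assumes "(\<lambda>n. f n / ln (ln (real n))) \<longlonglongrightarrow> c"
  shows "(\<lambda>n. f (cutoff n) / ln (ln (real n))) \<longlonglongrightarrow> c"
proof -
  have "(\<lambda>n. f (cutoff n) / ln (ln (real (cutoff n))) * (ln (ln (real (cutoff n))) / ln (ln (real n)))) \<longlonglongrightarrow> c * 1"
    by (intro tendsto_mult ln_ln_cutoff filterlim_compose[OF assms filterlim_cutoff])
  moreover have "\<forall>\<^sub>F n in sequentially. ln (ln (real (cutoff n))) > 0"
  proof -
    have "\<forall>\<^sub>F n in sequentially. ln (ln (real n)) > 0" by real_asymp
    then show ?thesis using filterlim_cutoff by (rule eventually_compose_filterlim)
  qed
  then have "\<forall>\<^sub>F n in sequentially. f (cutoff n) / ln (ln (real (cutoff n))) * (ln (ln (real (cutoff n))) / ln (ln (real n))) = f (cutoff n) / ln (ln (real n))"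
    by eventually_elim auto
  ultimately show ?thesis by (simp only: mult_1_right Lim_transform_eventually)
qed

text \<open>The primes up to a constant \<open>T\<close> contribute a bounded amount, and for the others an additional
  factor \<open>1 / p < 1 / T\<close> is available.\<close>

lemma S2_lim: "(\<lambda>n. S2 \<theta> n / ln (ln (real n))) \<longlonglongrightarrow> 0"
proof (rule LIMSEQ_I)
  fix e :: real assume e: "e > 0"
  have "M \<theta> \<ge> 0"
  proof (rule tendsto_lowerbound[OF S_lim])
    have "\<forall>\<^sub>F n in sequentially. ln (ln (real n)) > 0" by real_asymp
    then show "\<forall>\<^sub>F n in sequentially. 0 \<le> S \<theta> n / ln (ln (real n))"
      by eventually_elim (auto simp: S_def intro!: divide_nonneg_nonneg sum_nonneg)
  qed simp
  define T where "T = nat \<lceil>2 * (M \<theta> + 1) / e\<rceil> + 1"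
  have T: "T > 0" "real T \<ge> 2 * (M \<theta> + 1) / e" by (auto simp: T_def) linarith
  have "(\<lambda>n. c / ln (ln (real n))) \<longlonglongrightarrow> 0" for c :: real by real_asymp
  then have "\<forall>\<^sub>F n in sequentially. S2 \<theta> T / ln (ln (real n)) < e / 2"
    using e by (intro order_tendstoD) auto
  moreover have "\<forall>\<^sub>F n in sequentially. S \<theta> n / ln (ln (real n)) < M \<theta> + 1"
    by (rule order_tendstoD(2)[OF S_lim]) simp
  moreover have "\<forall>\<^sub>F n in sequentially. ln (ln (real n)) > 0" by real_asymp
  ultimately have "\<forall>\<^sub>F n in sequentially. norm (S2 \<theta> n / ln (ln (real n)) - 0) < e"
  proof eventually_elim
    case (elim n)
    have "S2 \<theta> n \<le> S2 \<theta> T + S \<theta> n / real T"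
    proof -
      have "S2 \<theta> n \<le> (\<Sum>p\<in>primes_upto n. (if p \<le> T then exp (\<theta> * g p) / real p ^ 2 else 0) + exp (\<theta> * g p) / real p / real T)"
        unfolding S2_def
      proof (rule sum_mono)
        fix p assume p: "p \<in> primes_upto n"
        then have "p > 0" by (auto simp: primes_upto_def prime_gt_0_nat)
        show "exp (\<theta> * g p) / real p ^ 2 \<le> (if p \<le> T then exp (\<theta> * g p) / real p ^ 2 else 0) + exp (\<theta> * g p) / real p / real T"
        proof (cases "p \<le> T")
          case False
          then have "exp (\<theta> * g p) / (real p * real p) \<le> exp (\<theta> * g p) / (real p * real T)"
            using T \<open>p > 0\<close> by (intro divide_left_mono mult_left_mono) auto
          then show ?thesis using False by (simp add: power2_eq_square)
        qed simp
      qed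
      also have "\<dots> = (\<Sum>p\<in>primes_upto n. if p \<le> T then exp (\<theta> * g p) / real p ^ 2 else 0) + S \<theta> n / real T"
        by (simp add: sum.distrib S_def sum_divide_distrib)
      also have "(\<Sum>p\<in>primes_upto n. if p \<le> T then exp (\<theta> * g p) / real p ^ 2 else 0) = (\<Sum>p\<in>{p\<in>primes_upto n. p \<le> T}. exp (\<theta> * g p) / real p ^ 2)"
        by (simp add: sum.inter_filter)
      also have "\<dots> \<le> S2 \<theta> T"
        unfolding S2_def by (rule sum_mono2) (auto simp: primes_upto_def)
      finally show ?thesis by simp
    qed
    then have "S2 \<theta> n / ln (ln (real n)) \<le> (S2 \<theta> T + S \<theta> n / real T) / ln (ln (real n))"
      using elim by (intro divide_right_mono) auto
    also have "\<dots> = S2 \<theta> T / ln (ln (real n)) + S \<theta> n / ln (ln (real n)) / real T"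
      by (simp add: add_divide_distrib mult.commute)
    also have "\<dots> < e / 2 + (M \<theta> + 1) / real T"
      using elim T by (intro add_strict_mono divide_strict_right_mono) auto
    also have "(M \<theta> + 1) / real T \<le> e / 2"
      using T e by (simp add: field_simps)
    finally have "S2 \<theta> n / ln (ln (real n)) < e" by simp
    moreover have "0 \<le> S2 \<theta> n / ln (ln (real n))"
      using elim by (auto simp: S2_def intro!: divide_nonneg_nonneg sum_nonneg)
    ultimately show ?case by simp
  qed
  then show "\<exists>no. \<forall>n\<ge>no. norm (S2 \<theta> n / ln (ln (real n)) - 0) < e"
    by (simp add: eventually_sequentially)
qed

text \<open>With \<open>h p = (exp (\<theta> * g p) - 1) / p\<close>, the inequalities \<open>h p - 2 * (h p)\<^sup>2 \<le> ln (1 + h p) \<le> h p\<close>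
  (valid since \<open>p \<ge> 2\<close> gives \<open>h p \<ge> -1/2\<close>) reduce the logarithm of the product to the sum of
  \<open>h p\<close>; the squares sum to \<open>o(ln (ln n))\<close> by \<open>S2_lim\<close> applied at \<open>2 * \<theta>\<close> and \<open>0\<close>.\<close>

lemma euler_product_asymp:
  "(\<lambda>n. ln (\<Prod>p\<in>primes_upto (cutoff n). 1 + (exp (\<theta> * g p) - 1) / real p) / ln (ln (real n))) \<longlonglongrightarrow> M \<theta> - 1"
proof -
  define h where "h = (\<lambda>p::nat. (exp (\<theta> * g p) - 1) / real p)"
  define A where "A = (\<lambda>N. S \<theta> N - S 0 N - 2 * (S2 (2 * \<theta>) N + S2 0 N))"
  define B where "B = (\<lambda>N. S \<theta> N - S 0 N)"
  have sum_h: "(\<Sum>p\<in>primes_upto N. h p) = B N" for N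
    by (simp add: h_def B_def S_def diff_divide_distrib sum_subtractf)
  have h_ge: "- 1 / 2 \<le> h p" if "p \<in> primes_upto N" for p N
  proof -
    have "real p \<ge> 2" using that prime_ge_2_nat[of p] by (auto simp: primes_upto_def)
    then have "- 1 / 2 \<le> - 1 / real p" by (simp add: field_simps)
    also have "\<dots> \<le> h p" unfolding h_def by (intro divide_right_mono) auto
    finally show ?thesis .
  qed
  have ln_eq: "ln (\<Prod>p\<in>primes_upto N. 1 + h p) = (\<Sum>p\<in>primes_upto N. ln (1 + h p))" for N
    using h_ge[of _ N] by (intro ln_prod) (auto simp: field_simps, fastforce)
  have upper: "ln (\<Prod>p\<in>primes_upto N. 1 + h p) \<le> B N" for N
    unfolding ln_eq sum_h[symmetric]
  proof (rule sum_mono)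
    fix p assume "p \<in> primes_upto N"
    then have "- 1 < h p" using h_ge[of p N] by linarith
    then show "ln (1 + h p) \<le> h p" by (rule ln_add_one_self_le_self2)
  qed
  have lower: "A N \<le> ln (\<Prod>p\<in>primes_upto N. 1 + h p)" for N
  proof -
    have "A N \<le> (\<Sum>p\<in>primes_upto N. h p - 2 * (exp (2 * \<theta> * g p) / real p ^ 2 + 1 / real p ^ 2))"
      unfolding sum_subtractf sum_h sum_distrib_left[symmetric] sum.distrib
      by (simp add: A_def B_def S2_def)
    also have "\<dots> \<le> (\<Sum>p\<in>primes_upto N. ln (1 + h p))"
    proof (rule sum_mono)
      fix p assume p: "p \<in> primes_upto N"
      have "(h p)\<^sup>2 = (exp (\<theta> * g p) - 1)\<^sup>2 / real p ^ 2" by (simp add: h_def power_divide)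
      also have "\<dots> \<le> (exp (2 * \<theta> * g p) + 1) / real p ^ 2"
      proof (rule divide_right_mono)
        have "exp (2 * \<theta> * g p) = exp (\<theta> * g p) ^ 2" by (simp add: exp_double[symmetric] mult.assoc)
        then show "(exp (\<theta> * g p) - 1)\<^sup>2 \<le> exp (2 * \<theta> * g p) + 1"
          by (simp add: power2_diff)
      qed simp
      finally have "h p - 2 * (exp (2 * \<theta> * g p) / real p ^ 2 + 1 / real p ^ 2) \<le> h p - 2 * (h p)\<^sup>2"
        by (simp add: add_divide_distrib)
      also have "\<dots> \<le> ln (1 + h p)" by (rule ln_one_plus_lower_bound[OF h_ge[OF p]])
      finally show "h p - 2 * (exp (2 * \<theta> * g p) / real p ^ 2 + 1 / real p ^ 2) \<le> ln (1 + h p)" .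
    qed
    finally show ?thesis by (simp only: ln_eq)
  qed
  have Blim: "(\<lambda>n. B n / ln (ln (real n))) \<longlonglongrightarrow> M \<theta> - 1"
    unfolding B_def diff_divide_distrib using tendsto_diff[OF S_lim S_lim[of 0]] M_0 by simp
  have Alim: "(\<lambda>n. A n / ln (ln (real n))) \<longlonglongrightarrow> M \<theta> - 1"
  proof -
    have "(\<lambda>n. B n / ln (ln (real n)) - 2 * (S2 (2 * \<theta>) n / ln (ln (real n)) + S2 0 n / ln (ln (real n)))) \<longlonglongrightarrow> (M \<theta> - 1) - 2 * (0 + 0)"
      by (intro tendsto_intros Blim S2_lim)
    then show ?thesis by (simp add: A_def B_def diff_divide_distrib add_divide_distrib)
  qed
  have pos: "\<forall>\<^sub>F n in sequentially. ln (ln (real n)) > 0" by real_asymp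
  have "(\<lambda>n. ln (\<Prod>p\<in>primes_upto (cutoff n). 1 + h p) / ln (ln (real n))) \<longlonglongrightarrow> M \<theta> - 1"
  proof (rule tendsto_sandwich)
    show "\<forall>\<^sub>F n in sequentially. A (cutoff n) / ln (ln (real n)) \<le> ln (\<Prod>p\<in>primes_upto (cutoff n). 1 + h p) / ln (ln (real n))"
      using pos by eventually_elim (intro divide_right_mono lower, simp)
    show "\<forall>\<^sub>F n in sequentially. ln (\<Prod>p\<in>primes_upto (cutoff n). 1 + h p) / ln (ln (real n)) \<le> B (cutoff n) / ln (ln (real n))"
      using pos by eventually_elim (intro divide_right_mono upper, simp)
  qed (rule at_cutoff[OF Alim] at_cutoff[OF Blim])+
  then show ?thesis by (simp add: h_def)
qed

lemma mean_value_error_small_primes: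
  "\<exists>c. \<forall>\<^sub>F n in sequentially.
    \<bar>(\<Sum>m=1..n. exp (\<theta> * additive_part g (primes_upto (cutoff n)) m)) / real n
      - (\<Prod>p\<in>primes_upto (cutoff n). 1 + (exp (\<theta> * g p) - 1) / real p)\<bar>
    \<le> exp (c * ln (ln (real n)) - (ln (ln (real n)))\<^sup>2)"
proof (intro exI)
  define C where "C = M \<theta> + 2"
  have "(\<lambda>n. (S \<theta> n + S 0 n) / ln (ln (real n))) \<longlonglongrightarrow> M \<theta> + M 0"
    unfolding add_divide_distrib by (intro tendsto_add S_lim)
  from at_cutoff[OF this] have "\<forall>\<^sub>F n in sequentially. (S \<theta> (cutoff n) + S 0 (cutoff n)) / ln (ln (real n)) < C"
    by (rule order_tendstoD) (simp add: C_def M_0)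
  moreover have "\<forall>\<^sub>F n in sequentially. ln (ln (real n)) > 0" by real_asymp
  moreover have "\<forall>\<^sub>F n in sequentially. (ln (ln (real n)))\<^sup>2 / ln (real n) < 1" by real_asymp
  moreover have "\<forall>\<^sub>F n in sequentially. ln (real n) > 0" by real_asymp
  ultimately show "\<forall>\<^sub>F n in sequentially.
    \<bar>(\<Sum>m=1..n. exp (\<theta> * additive_part g (primes_upto (cutoff n)) m)) / real n
      - (\<Prod>p\<in>primes_upto (cutoff n). 1 + (exp (\<theta> * g p) - 1) / real p)\<bar>
    \<le> exp (exp 1 * C * ln (ln (real n)) - (ln (ln (real n)))\<^sup>2)"
    using eventually_gt_at_top[of 0]
  proof eventually_elim
    case (elim n)
    let ?Q = "primes_upto (cutoff n)"
    define L where "L = ln (ln (real n))"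
    \<comment> \<open>the choice that makes \<open>p powr s \<le> exp 1\<close> for all primes up to \<open>cutoff n\<close>\<close>
    define s where "s = L\<^sup>2 / ln (real n)"
    define h where "h = (\<lambda>p. exp (\<theta> * g p) - 1)"
    have L: "L > 0" and s: "0 \<le> s" "s \<le> 1" using elim by (auto simp: L_def s_def)
    have n_powr: "real n powr - s = exp (- L\<^sup>2)" using elim by (simp add: powr_def s_def)
    have p_powr: "real p powr s \<le> exp 1" if "p \<in> ?Q" for p
    proof -
      have "real p \<le> real (cutoff n)" using that by (simp add: primes_upto_def)
      also have "\<dots> \<le> real n powr (1 / L\<^sup>2)" by (simp add: cutoff_def L_def)
      finally have "real p powr s \<le> (real n powr (1 / L\<^sup>2)) powr s" using s by (intro powr_mono2) auto
      also have "\<dots> = exp 1" using elim L by (simp add: powr_powr powr_def s_def)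
      finally show ?thesis .
    qed
    have "\<bar>(\<Sum>m=1..n. \<Prod>p\<in>?Q. 1 + (if p dvd m then h p else 0)) / real n - (\<Prod>p\<in>?Q. 1 + h p / real p)\<bar>
      \<le> real n powr - s * (\<Prod>p\<in>?Q. 1 + \<bar>h p\<bar> * real p powr s / real p)"
      using elim s by (intro mean_value_error) (auto dest: prime_primes_upto)
    also have "\<dots> \<le> exp (- L\<^sup>2) * (\<Prod>p\<in>?Q. exp (exp 1 * ((exp (\<theta> * g p) + 1) / real p)))"
      unfolding n_powr
    proof (intro mult_left_mono prod_mono conjI)
      fix p assume p: "p \<in> ?Q"
      have "\<bar>h p\<bar> \<le> exp (\<theta> * g p) + 1" by (simp add: h_def abs_le_iff add_nonneg_nonneg)
      then have "\<bar>h p\<bar> * real p powr s \<le> (exp (\<theta> * g p) + 1) * exp 1"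
        using p_powr[OF p] by (intro mult_mono) (auto simp: add_nonneg_nonneg)
      then have "\<bar>h p\<bar> * real p powr s / real p \<le> exp 1 * ((exp (\<theta> * g p) + 1) / real p)"
        by (simp add: divide_right_mono mult.commute)
      then show "1 + \<bar>h p\<bar> * real p powr s / real p \<le> exp (exp 1 * ((exp (\<theta> * g p) + 1) / real p))"
        by (smt (verit) exp_ge_add_one_self)
    qed auto
    also have "\<dots> = exp (exp 1 * (S \<theta> (cutoff n) + S 0 (cutoff n)) - L\<^sup>2)"
      by (simp add: exp_sum[symmetric] sum_distrib_left[symmetric] exp_add[symmetric] S_def sum.distrib[symmetric] add_divide_distrib)
    also have "\<dots> \<le> exp (exp 1 * C * L - L\<^sup>2)"
    proof -
      have "S \<theta> (cutoff n) + S 0 (cutoff n) \<le> C * L"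
        using elim(1) L by (simp add: L_def pos_divide_less_eq less_imp_le)
      then have "exp 1 * (S \<theta> (cutoff n) + S 0 (cutoff n)) \<le> exp 1 * (C * L)" by (intro mult_left_mono) auto
      then show ?thesis by (simp add: mult.assoc)
    qed
    finally show ?case
      by (simp only: exp_additive_part[OF finite_primes_upto] h_def L_def)
  qed
qed

text \<open>The Euler product is at least \<open>exp (c * L)\<close> for some constant \<open>c\<close>, possibly negative, where
  \<open>L = ln (ln n)\<close>. An absolute error of size \<open>exp (O(L) - L\<^sup>2)\<close> is therefore also a small relative
  error.\<close>

lemma small_primes_asymp:
  "(\<lambda>n. log_mean_exp n (\<lambda>m. \<theta> * additive_part g (primes_upto (cutoff n)) m) / ln (ln (real n))) \<longlonglongrightarrow> M \<theta> - 1"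
proof -
  define L where "L = (\<lambda>n. ln (ln (real n)))"
  define E where "E = (\<lambda>n. (\<Sum>m=1..n. exp (\<theta> * additive_part g (primes_upto (cutoff n)) m)) / real n)"
  define D where "D = (\<lambda>n. \<Prod>p\<in>primes_upto (cutoff n). 1 + (exp (\<theta> * g p) - 1) / real p)"
  obtain c where c: "\<forall>\<^sub>F n in sequentially. \<bar>E n - D n\<bar> \<le> exp (c * L n - (L n)\<^sup>2)"
    using mean_value_error_small_primes[of \<theta>] by (auto simp: E_def D_def L_def)
  have Dlim: "(\<lambda>n. ln (D n) / L n) \<longlonglongrightarrow> M \<theta> - 1"
    using euler_product_asymp[of \<theta>] by (simp add: D_def L_def)
  have D_pos: "D n > 0" for n
    unfolding D_def
  proof (rule prod_pos)
    fix p assume "p \<in> primes_upto (cutoff n)"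
    then have p: "real p \<ge> 2" using prime_ge_2_nat[of p] by (auto simp: primes_upto_def)
    then have "0 < 1 - 1 / real p" by (simp add: field_simps)
    also have "\<dots> \<le> 1 + (exp (\<theta> * g p) - 1) / real p" using p by (simp add: field_simps)
    finally show "0 < 1 + (exp (\<theta> * g p) - 1) / real p" .
  qed
  have pos: "\<forall>\<^sub>F n in sequentially. L n > 0" unfolding L_def by real_asymp
  have ratio: "(\<lambda>n. E n / D n) \<longlonglongrightarrow> 1"
  proof (rule LIM_zero_cancel, rule Lim_null_comparison)
    define c' where "c' = c - (M \<theta> - 2)"
    have "\<forall>\<^sub>F n in sequentially. M \<theta> - 2 < ln (D n) / L n"
      by (rule order_tendstoD(1)[OF Dlim]) simp
    with c pos show "\<forall>\<^sub>F n in sequentially. norm (E n / D n - 1) \<le> exp (c' * L n - (L n)\<^sup>2)"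
    proof eventually_elim
      case (elim n)
      have "(M \<theta> - 2) * L n \<le> ln (D n)" using elim by (simp add: pos_less_divide_eq less_imp_le)
      then have *: "exp ((M \<theta> - 2) * L n) \<le> D n" using D_pos[of n] by (simp add: ln_ge_iff)
      have "norm (E n / D n - 1) = \<bar>E n - D n\<bar> / D n" using D_pos[of n] by (simp add: field_simps)
      also have "\<dots> \<le> exp (c * L n - (L n)\<^sup>2) / exp ((M \<theta> - 2) * L n)"
        using elim * by (intro frac_le) auto
      also have "\<dots> = exp (c' * L n - (L n)\<^sup>2)"
        by (simp add: exp_diff[symmetric] c'_def algebra_simps)
      finally show ?case .
    qed
    show "(\<lambda>n. exp (c' * L n - (L n)\<^sup>2)) \<longlonglongrightarrow> 0" unfolding L_def by real_asymp
  qed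
  have "(\<lambda>n. ln (E n / D n)) \<longlonglongrightarrow> ln 1" by (intro tendsto_ln ratio) simp
  moreover have "filterlim L at_top sequentially" unfolding L_def by real_asymp
  ultimately have "(\<lambda>n. ln (E n / D n) / L n) \<longlonglongrightarrow> 0"
    by (intro tendsto_divide_0[OF _ filterlim_at_top_imp_at_infinity]) auto
  from tendsto_add[OF Dlim this] have "(\<lambda>n. ln (D n) / L n + ln (E n / D n) / L n) \<longlonglongrightarrow> M \<theta> - 1" by simp
  moreover have "\<forall>\<^sub>F n in sequentially. ln (D n) / L n + ln (E n / D n) / L n = ln (E n) / L n"
    using eventually_gt_at_top[of 0]
  proof eventually_elim
    case (elim n)
    have "E n > 0" using sum_exp_pos[OF elim] elim by (simp add: E_def)
    then show ?case using D_pos[of n] by (simp add: ln_div add_divide_distrib[symmetric])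
  qed
  ultimately have "(\<lambda>n. ln (E n) / L n) \<longlonglongrightarrow> M \<theta> - 1" by (rule Lim_transform_eventually)
  then show ?thesis by (simp add: log_mean_exp_def E_def L_def)
qed

text \<open>Hoelder's inequality asks for no more than this upper bound, but for parameters \<open>\<theta>\<close> of both signs
  and of any size. Replacing \<open>exp (\<theta> * g p)\<close> by \<open>1 + exp (\<theta> * g p)\<close> makes the factors
  at least \<open>1\<close>, so that \<open>mean_value_upper_bound\<close> applies to primes of any size.\<close>

lemma large_primes_negligible:
  assumes "e > 0"
  shows "\<forall>\<^sub>F n in sequentially.
    log_mean_exp n (\<lambda>m. \<theta> * additive_part g (primes_upto n - primes_upto (cutoff n)) m) / ln (ln (real n)) < e"
proof -
  have "(\<lambda>n. S \<theta> n / ln (ln (real n)) - S \<theta> (cutoff n) / ln (ln (real n))) \<longlonglongrightarrow> M \<theta> - M \<theta>"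
    by (intro tendsto_diff S_lim at_cutoff)
  then have "\<forall>\<^sub>F n in sequentially. S \<theta> n / ln (ln (real n)) - S \<theta> (cutoff n) / ln (ln (real n)) < e"
    using assms by (intro order_tendstoD) auto
  moreover have "\<forall>\<^sub>F n in sequentially. ln (ln (real n)) > 0" by real_asymp
  ultimately show ?thesis using cutoff_le eventually_gt_at_top[of 0]
  proof eventually_elim
    case (elim n)
    let ?Q = "primes_upto n - primes_upto (cutoff n)"
    have sub: "primes_upto (cutoff n) \<subseteq> primes_upto n" using elim(3) by (auto simp: primes_upto_def)
    have "(\<Sum>m=1..n. exp (\<theta> * additive_part g ?Q m)) \<le> (\<Sum>m=1..n. \<Prod>p\<in>?Q. 1 + (if p dvd m then exp (\<theta> * g p) else 0))"
      by (subst exp_additive_part) (auto intro!: sum_mono prod_mono)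
    also have "\<dots> / real n \<le> exp (\<Sum>p\<in>?Q. exp (\<theta> * g p) / real p)"
      using elim by (intro mean_value_upper_bound) (auto dest: prime_primes_upto)
    finally have "(\<Sum>m=1..n. exp (\<theta> * additive_part g ?Q m)) / real n \<le> exp (\<Sum>p\<in>?Q. exp (\<theta> * g p) / real p)"
      by (simp add: divide_right_mono)
    also have "(\<Sum>p\<in>?Q. exp (\<theta> * g p) / real p) = S \<theta> n - S \<theta> (cutoff n)"
      unfolding S_def using sub by (intro sum_diff) auto
    finally have "ln ((\<Sum>m=1..n. exp (\<theta> * additive_part g ?Q m)) / real n) \<le> ln (exp (S \<theta> n - S \<theta> (cutoff n)))"
      using sum_exp_pos elim by (intro ln_mono) auto
    then have "log_mean_exp n (\<lambda>m. \<theta> * additive_part g ?Q m) / ln (ln (real n)) \<le> (S \<theta> n - S \<theta> (cutoff n)) / ln (ln (real n))"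
      using elim by (intro divide_right_mono) (auto simp: log_mean_exp_def)
    also have "\<dots> < e" using elim(1) by (simp add: diff_divide_distrib)
    finally show ?case .
  qed
qed

text \<open>Write \<open>g m = A m + B m\<close> with the primes up to and beyond the cutoff. Hoelder's inequality is
  used for \<open>\<theta> * (A m + B m)\<close> to bound the mean of \<open>exp (\<theta> * g m)\<close> from above, and for
  \<open>(1 - t) * \<theta> * A m = (1 - t) * (\<theta> * g m) + t * (- (1 - t) / t * \<theta> * B m)\<close> to bound it from below.
  The terms in \<open>B\<close> are negligible for every fixed \<open>t\<close>, and \<open>t\<close> tending to \<open>0\<close> recovers the
  parameter \<open>\<theta>\<close> by continuity.\<close>

lemma log_mgf_asymp:
  assumes g: "strongly_additive g" and cont: "\<And>\<theta>. isCont M \<theta>"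
  shows "(\<lambda>n. log_mean_exp n (\<lambda>m. \<theta> * g m) / ln (ln (real n))) \<longlonglongrightarrow> M \<theta> - 1"
proof -
  define L where "L = (\<lambda>n. ln (ln (real n)))"
  define X where "X = (\<lambda>n. additive_part g (primes_upto n))"
  define A where "A = (\<lambda>n. additive_part g (primes_upto (cutoff n)))"
  define B where "B = (\<lambda>n. additive_part g (primes_upto n - primes_upto (cutoff n)))"
  define \<Lambda> where "\<Lambda> = (\<lambda>\<theta>. M \<theta> - 1)"
  have Alim: "(\<lambda>n. log_mean_exp n (\<lambda>m. \<theta> * A n m) / L n) \<longlonglongrightarrow> \<Lambda> \<theta>" for \<theta>
    using small_primes_asymp[of \<theta>] by (simp add: A_def L_def \<Lambda>_def)
  have Bsmall: "\<forall>\<^sub>F n in sequentially. log_mean_exp n (\<lambda>m. \<theta> * B n m) / L n < e" if "e > 0" for e \<theta>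
    using large_primes_negligible[OF that, of \<theta>] by (simp add: B_def L_def)
  have split: "\<forall>\<^sub>F n in sequentially. \<forall>m. X n m = A n m + B n m"
    using cutoff_le
  proof eventually_elim
    case (elim n)
    then have "primes_upto (cutoff n) \<subseteq> primes_upto n" by (auto simp: primes_upto_def)
    then show ?case by (auto simp: X_def A_def B_def intro: additive_part_split)
  qed
  have pos: "\<forall>\<^sub>F n in sequentially. L n > 0" unfolding L_def by real_asymp
  have contL: "isCont \<Lambda> \<theta>" for \<theta> unfolding \<Lambda>_def by (intro continuous_intros cont)
  have "(\<lambda>n. log_mean_exp n (\<lambda>m. \<theta> * X n m) / L n) \<longlonglongrightarrow> \<Lambda> \<theta>"
  proof (rule order_tendstoI)
    fix a assume "a < \<Lambda> \<theta>"
    have "((\<lambda>t. (1 / (1 - t)) * (\<Lambda> ((1 - t) * \<theta>) - t)) \<longlongrightarrow> (1 / (1 - 0)) * (\<Lambda> ((1 - 0) * \<theta>) - 0)) (at_right 0)"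
      by (intro tendsto_intros isCont_tendsto_compose[OF contL]) auto
    then have "\<forall>\<^sub>F t in at_right 0. a < (1 / (1 - t)) * (\<Lambda> ((1 - t) * \<theta>) - t)"
      using \<open>a < \<Lambda> \<theta>\<close> by (intro order_tendstoD) auto
    moreover have "\<forall>\<^sub>F t in at_right 0. t \<in> {0<..<1::real}"
      by (rule eventually_at_right_real) simp
    ultimately have "\<forall>\<^sub>F t in at_right 0. a < (1 / (1 - t)) * (\<Lambda> ((1 - t) * \<theta>) - t) \<and> t \<in> {0<..<1::real}"
      by eventually_elim simp
    then obtain t where t: "a < (1 / (1 - t)) * (\<Lambda> ((1 - t) * \<theta>) - t)" "0 < t" "t < 1"
      using eventually_happens'[OF trivial_limit_at_right_real] by (metis (no_types, lifting) greaterThanLessThan_iff)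
    have "a * (1 - t) + t < \<Lambda> ((1 - t) * \<theta>)" using t by (simp add: field_simps)
    from order_tendstoD(1)[OF Alim this] Bsmall[OF zero_less_one, of "- (1 - t) / t * \<theta>"] split pos eventually_gt_at_top[of 0]
    show "\<forall>\<^sub>F n in sequentially. a < log_mean_exp n (\<lambda>m. \<theta> * X n m) / L n"
    proof eventually_elim
      case (elim n)
      define u where "u = log_mean_exp n (\<lambda>m. \<theta> * X n m)"
      define v where "v = log_mean_exp n (\<lambda>m. - (1 - t) / t * \<theta> * B n m)"
      have "(\<lambda>m. (1 - t) * \<theta> * A n m) = (\<lambda>m. (1 - t) * (\<theta> * X n m) + t * (- (1 - t) / t * \<theta> * B n m))"
        using elim t by (auto simp: field_simps)
      then have "log_mean_exp n (\<lambda>m. (1 - t) * \<theta> * A n m) \<le> (1 - t) * u + t * v"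
        using log_mean_exp_convex[of n t "\<lambda>m. \<theta> * X n m" "\<lambda>m. - (1 - t) / t * \<theta> * B n m"] elim t by (simp add: u_def v_def)
      moreover have "t * v \<le> t * L n"
        using elim t by (intro mult_left_mono) (auto simp: v_def pos_divide_less_eq)
      moreover have "(a * (1 - t) + t) * L n < log_mean_exp n (\<lambda>m. (1 - t) * \<theta> * A n m)"
        using elim by (simp add: pos_less_divide_eq)
      ultimately have "(1 - t) * (a * L n) < (1 - t) * u" by (simp add: algebra_simps)
      then have "a * L n < u" using t by simp
      then show ?case using elim by (simp add: u_def pos_less_divide_eq)
    qed
  next
    fix a assume "\<Lambda> \<theta> < a"
    have "((\<lambda>t. (1 - t) * \<Lambda> ((1 / (1 - t)) * \<theta>) + t) \<longlongrightarrow> (1 - 0) * \<Lambda> ((1 / (1 - 0)) * \<theta>) + 0) (at_right 0)"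
      by (intro tendsto_intros isCont_tendsto_compose[OF contL]) auto
    then have "\<forall>\<^sub>F t in at_right 0. (1 - t) * \<Lambda> ((1 / (1 - t)) * \<theta>) + t < a"
      using \<open>\<Lambda> \<theta> < a\<close> by (intro order_tendstoD) auto
    moreover have "\<forall>\<^sub>F t in at_right 0. t \<in> {0<..<1::real}"
      by (rule eventually_at_right_real) simp
    ultimately have "\<forall>\<^sub>F t in at_right 0. (1 - t) * \<Lambda> ((1 / (1 - t)) * \<theta>) + t < a \<and> t \<in> {0<..<1::real}"
      by eventually_elim simp
    then obtain t where t: "(1 - t) * \<Lambda> ((1 / (1 - t)) * \<theta>) + t < a" "0 < t" "t < 1"
      using eventually_happens'[OF trivial_limit_at_right_real] by (metis (no_types, lifting) greaterThanLessThan_iff)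
    have "\<Lambda> ((1 / (1 - t)) * \<theta>) < (a - t) / (1 - t)" using t by (simp add: field_simps)
    from order_tendstoD(2)[OF Alim this] Bsmall[OF zero_less_one, of "1 / t * \<theta>"] split pos eventually_gt_at_top[of 0]
    show "\<forall>\<^sub>F n in sequentially. log_mean_exp n (\<lambda>m. \<theta> * X n m) / L n < a"
    proof eventually_elim
      case (elim n)
      define u where "u = log_mean_exp n (\<lambda>m. 1 / (1 - t) * \<theta> * A n m)"
      define v where "v = log_mean_exp n (\<lambda>m. 1 / t * \<theta> * B n m)"
      have "(\<lambda>m. \<theta> * X n m) = (\<lambda>m. (1 - t) * (1 / (1 - t) * \<theta> * A n m) + t * (1 / t * \<theta> * B n m))"
        using elim t by (auto simp: field_simps)
      then have "log_mean_exp n (\<lambda>m. \<theta> * X n m) \<le> (1 - t) * u + t * v"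
        using log_mean_exp_convex[of n t "\<lambda>m. 1 / (1 - t) * \<theta> * A n m" "\<lambda>m. 1 / t * \<theta> * B n m"] elim t by (simp add: u_def v_def)
      also have "t * v \<le> t * L n"
        using elim t by (intro mult_left_mono) (auto simp: v_def pos_divide_less_eq)
      also have "(1 - t) * u < (1 - t) * ((a - t) / (1 - t) * L n)"
        using elim t by (intro mult_strict_left_mono) (auto simp: u_def pos_divide_less_eq)
      also have "(1 - t) * ((a - t) / (1 - t) * L n) = (a - t) * L n" using t by simp
      also have "(a - t) * L n + t * L n = a * L n" by (simp add: algebra_simps)
      finally show ?case using elim by (simp add: pos_divide_less_eq)
    qed
  qed
  moreover have "log_mean_exp n (\<lambda>m. \<theta> * X n m) = log_mean_exp n (\<lambda>m. \<theta> * g m)" for n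
  proof -
    have "(\<Sum>m=1..n. exp (\<theta> * X n m)) = (\<Sum>m=1..n. exp (\<theta> * g m))"
      unfolding X_def by (rule sum.cong) (simp_all add: strongly_additive_eq_additive_part[OF g, symmetric])
    then show ?thesis by (simp only: log_mean_exp_def)
  qed
  ultimately show ?thesis by (simp add: L_def \<Lambda>_def)
qed

end

section \<open>The moment generating function of the limit law\<close>

lemma abs_exp_minus_one_minus_le:
  fixes x :: real
  shows "\<bar>exp x - 1 - x\<bar> \<le> x\<^sup>2 * exp \<bar>x\<bar>"
proof -
  obtain t where t: "\<bar>t\<bar> \<le> \<bar>x\<bar>" "exp x = (\<Sum>m<2. x ^ m / fact m) + exp t / fact 2 * x ^ 2"
    using Maclaurin_exp_le[of x 2] by blast
  then have "\<bar>exp x - 1 - x\<bar> = x\<^sup>2 * (exp t / 2)"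
    by (simp add: numeral_2_eq_2)
  also have "\<dots> \<le> x\<^sup>2 * exp \<bar>x\<bar>"
  proof (rule mult_left_mono)
    have "exp t \<le> exp \<bar>x\<bar>" using t(1) by simp
    then show "exp t / 2 \<le> exp \<bar>x\<bar>" using exp_gt_zero[of t] by linarith
  qed simp
  finally show ?thesis .
qed

text \<open>The second order Taylor remainder of \<open>exp (h * y)\<close> is bounded by \<open>h\<^sup>2\<close> times a function with
  exponential growth, which all the exponential moments of \<open>\<rho>\<close> integrate.\<close>

lemma has_real_derivative_mgf:
  fixes \<rho> :: "real measure"
  assumes sets [measurable_cong]: "sets \<rho> = sets borel"
    and int: "\<And>\<theta>::real. integrable \<rho> (\<lambda>y. exp (\<theta> * y))"
  shows "((\<lambda>\<theta>. \<integral>y. exp (\<theta> * y) \<partial>\<rho>) has_real_derivative (\<integral>y. y * exp (\<theta> * y) \<partial>\<rho>)) (at \<theta>)"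
proof -
  have int': "integrable \<rho> (\<lambda>y. y * exp (\<theta> * y))"
  proof (rule Bochner_Integration.integrable_bound)
    show "integrable \<rho> (\<lambda>y. exp ((\<theta> + 1) * y) + exp ((\<theta> - 1) * y))" using int by simp
    show "AE y in \<rho>. norm (y * exp (\<theta> * y)) \<le> norm (exp ((\<theta> + 1) * y) + exp ((\<theta> - 1) * y))"
    proof (rule AE_I2)
      fix y :: real
      have "\<bar>y\<bar> \<le> exp \<bar>y\<bar>" using exp_ge_add_one_self[of "\<bar>y\<bar>"] by linarith
      also have "\<dots> \<le> exp y + exp (- y)" by (cases "y \<ge> 0") auto
      finally have "\<bar>y\<bar> * exp (\<theta> * y) \<le> (exp y + exp (- y)) * exp (\<theta> * y)" by (intro mult_right_mono) auto
      also have "\<dots> = exp ((\<theta> + 1) * y) + exp ((\<theta> - 1) * y)"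
        by (simp add: distrib_right exp_add[symmetric] algebra_simps)
      finally show "norm (y * exp (\<theta> * y)) \<le> norm (exp ((\<theta> + 1) * y) + exp ((\<theta> - 1) * y))"
        by (simp add: abs_mult)
    qed
  qed measurable
  define K where "K = (\<integral>y. 2 * (exp ((\<theta> + 2) * y) + exp ((\<theta> - 2) * y)) \<partial>\<rho>)"
  let ?M = "\<lambda>\<theta>. \<integral>y. exp (\<theta> * y) \<partial>\<rho>"
  let ?D = "\<integral>y. y * exp (\<theta> * y) \<partial>\<rho>"
  have bound: "\<bar>?M (\<theta> + h) - ?M \<theta> - h * ?D\<bar> \<le> h\<^sup>2 * K" if h: "\<bar>h\<bar> \<le> 1" for h
  proof -
    have pw: "\<bar>exp ((\<theta> + h) * y) - exp (\<theta> * y) - h * (y * exp (\<theta> * y))\<bar> \<le> h\<^sup>2 * (2 * (exp ((\<theta> + 2) * y) + exp ((\<theta> - 2) * y)))" for y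
    proof -
      have "exp ((\<theta> + h) * y) - exp (\<theta> * y) - h * (y * exp (\<theta> * y)) = exp (\<theta> * y) * (exp (h * y) - 1 - h * y)"
        by (simp add: algebra_simps exp_add)
      then have "\<bar>exp ((\<theta> + h) * y) - exp (\<theta> * y) - h * (y * exp (\<theta> * y))\<bar> = exp (\<theta> * y) * \<bar>exp (h * y) - 1 - h * y\<bar>"
        by (simp add: abs_mult)
      also have "\<dots> \<le> exp (\<theta> * y) * ((h * y)\<^sup>2 * exp \<bar>h * y\<bar>)"
        by (intro mult_left_mono abs_exp_minus_one_minus_le) auto
      also have "\<dots> \<le> exp (\<theta> * y) * ((h * y)\<^sup>2 * exp \<bar>y\<bar>)"
        using mult_right_mono[OF h, of "\<bar>y\<bar>"] by (intro mult_left_mono) (auto simp: abs_mult)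
      also have "\<dots> = h\<^sup>2 * (exp (\<theta> * y) * (y\<^sup>2 * exp \<bar>y\<bar>))" by (simp add: power_mult_distrib mult_ac)
      also have "\<dots> \<le> h\<^sup>2 * (exp (\<theta> * y) * ((2 * exp \<bar>y\<bar>) * exp \<bar>y\<bar>))"
      proof -
        have "y\<^sup>2 \<le> 2 * exp \<bar>y\<bar>" using exp_lower_Taylor_quadratic[of "\<bar>y\<bar>"] by simp
        then show ?thesis by (intro mult_left_mono mult_right_mono) auto
      qed
      also have "\<dots> \<le> h\<^sup>2 * (2 * (exp ((\<theta> + 2) * y) + exp ((\<theta> - 2) * y)))"
      proof (rule mult_left_mono)
        have "exp (\<theta> * y) * ((2 * exp \<bar>y\<bar>) * exp \<bar>y\<bar>) = 2 * exp (\<theta> * y + 2 * \<bar>y\<bar>)"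
          by (simp only: exp_add mult_2) (simp add: mult_ac)
        also have "\<dots> \<le> 2 * (exp ((\<theta> + 2) * y) + exp ((\<theta> - 2) * y))"
          by (cases "y \<ge> 0") (auto simp: algebra_simps)
        finally show "exp (\<theta> * y) * ((2 * exp \<bar>y\<bar>) * exp \<bar>y\<bar>) \<le> 2 * (exp ((\<theta> + 2) * y) + exp ((\<theta> - 2) * y))" .
      qed simp
      finally show ?thesis .
    qed
    have "?M (\<theta> + h) - ?M \<theta> - h * ?D = (\<integral>y. exp ((\<theta> + h) * y) - exp (\<theta> * y) - h * (y * exp (\<theta> * y)) \<partial>\<rho>)"
      using int int' by simp
    then have "\<bar>?M (\<theta> + h) - ?M \<theta> - h * ?D\<bar> \<le> (\<integral>y. \<bar>exp ((\<theta> + h) * y) - exp (\<theta> * y) - h * (y * exp (\<theta> * y))\<bar> \<partial>\<rho>)"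
      by (simp only: integral_abs_bound)
    also have "\<dots> \<le> (\<integral>y. h\<^sup>2 * (2 * (exp ((\<theta> + 2) * y) + exp ((\<theta> - 2) * y))) \<partial>\<rho>)"
      using int int' pw by (intro integral_mono) auto
    also have "\<dots> = h\<^sup>2 * K" by (simp add: K_def)
    finally show ?thesis .
  qed
  show ?thesis
    unfolding DERIV_def
  proof (rule LIM_zero_cancel, rule Lim_null_comparison)
    show "\<forall>\<^sub>F h in at 0. norm ((?M (\<theta> + h) - ?M \<theta>) / h - ?D) \<le> \<bar>h\<bar> * K"
      unfolding eventually_at
    proof (intro exI[of _ 1] conjI ballI impI)
      fix h :: real assume "h \<noteq> 0 \<and> dist h 0 < 1"
      then have h: "h \<noteq> 0" "\<bar>h\<bar> \<le> 1" by auto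
      have "norm ((?M (\<theta> + h) - ?M \<theta>) / h - ?D) = \<bar>?M (\<theta> + h) - ?M \<theta> - h * ?D\<bar> / \<bar>h\<bar>"
        using h(1) by (simp add: abs_divide[symmetric] diff_divide_distrib)
      also have "\<dots> \<le> h\<^sup>2 * K / \<bar>h\<bar>" using bound[OF h(2)] by (intro divide_right_mono) auto
      also have "\<dots> = \<bar>h\<bar> * K" using h(1) by (simp add: power2_eq_square abs_if)
      finally show "norm ((?M (\<theta> + h) - ?M \<theta>) / h - ?D) \<le> \<bar>h\<bar> * K" .
    qed simp
    show "((\<lambda>h. \<bar>h\<bar> * K) \<longlongrightarrow> 0) (at 0)" by (auto intro!: tendsto_eq_intros)
  qed
qed

lemma integral_prime_law:
  "(\<integral>y. exp (\<theta> * y) \<partial>prime_law g n)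
    = (\<Sum>p\<in>primes_upto n. exp (\<theta> * g p) / real p) / (\<Sum>p\<in>primes_upto n. 1 / real p)"
proof -
  have "(\<integral>y. exp (\<theta> * y) \<partial>prime_law g n) = (\<integral>p. exp (\<theta> * g p) \<partial>point_measure (primes_upto n)
      (\<lambda>p. ennreal ((1 / real p) / (\<Sum>q\<in>primes_upto n. 1 / real q))))"
    unfolding prime_law_def primes_upto_def by (rule integral_distr) simp_all
  also have "\<dots> = (\<Sum>p\<in>primes_upto n. (1 / real p) / (\<Sum>q\<in>primes_upto n. 1 / real q) * exp (\<theta> * g p))"
    by (subst lebesgue_integral_point_measure_finite) (auto intro!: mult_nonneg_nonneg divide_nonneg_nonneg sum_nonneg)
  finally show ?thesis by (simp add: sum_divide_distrib mult.commute)
qed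

lemma integral_uniform_law:
  assumes "n > 0" "b \<noteq> 0"
  shows "integrable (distr (measure_pmf (pmf_of_set {1..n})) borel (\<lambda>v. g v / b)) (\<lambda>x. exp (b * \<theta> * x))" (is ?A)
    and "ln (\<integral>x. exp (b * \<theta> * x) \<partial>distr (measure_pmf (pmf_of_set {1..n})) borel (\<lambda>v. g v / b)) = log_mean_exp n (\<lambda>m. \<theta> * g m)" (is ?B)
proof -
  have eq: "exp (b * \<theta> * (g v / b)) = exp (\<theta> * g v)" for v using assms by simp
  have ne: "{1..n} \<noteq> {}" using assms by simp
  show ?A
    using ne by (subst integrable_distr_eq) (auto intro!: integrable_measure_pmf_finite simp: set_pmf_of_set)
  have "(\<integral>x. exp (b * \<theta> * x) \<partial>distr (measure_pmf (pmf_of_set {1..n})) borel (\<lambda>v. g v / b))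
      = measure_pmf.expectation (pmf_of_set {1..n}) (\<lambda>v. exp (b * \<theta> * (g v / b)))"
    by (rule integral_distr) simp_all
  also have "\<dots> = (\<Sum>m=1..n. exp (\<theta> * g m)) / real n"
    unfolding eq using integral_pmf_of_set[OF ne, of "\<lambda>v. exp (\<theta> * g v)"] by simp
  finally show ?B by (simp only: log_mean_exp_def)
qed

theorem theorem2:
  fixes g :: "nat \<Rightarrow> real" and \<rho> :: "real measure"
  assumes "strongly_additive g"
    and "prob_space \<rho>" and "sets \<rho> = sets borel"
    and "\<And>\<theta>::real. integrable \<rho> (\<lambda>y. exp (\<theta> * y))"
    and "\<And>\<theta>::real. (\<lambda>n. \<integral>y. exp (\<theta> * y) \<partial>prime_law g n) \<longlonglongrightarrow> (\<integral>y. exp (\<theta> * y) \<partial>\<rho>)"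
  shows "large_deviation_principle
           (\<lambda>n. distr (measure_pmf (pmf_of_set {1..n})) borel (\<lambda>v. g v / ln (ln (real n))))
           (\<lambda>n. ln (ln (real n)))
           (\<lambda>x. SUP \<theta>::real. ereal (\<theta> * x - (\<integral>y. (exp (\<theta> * y) - 1) \<partial>\<rho>)))"
proof -
  interpret \<rho>: prob_space \<rho> by fact
  define M where "M = (\<lambda>\<theta>. \<integral>y. exp (\<theta> * y) \<partial>\<rho>)"
  have \<Lambda>: "(\<integral>y. (exp (\<theta> * y) - 1) \<partial>\<rho>) = M \<theta> - 1" for \<theta>
    using assms(4)[of \<theta>] by (simp add: M_def \<rho>.prob_space)
  have der: "(M has_real_derivative (\<integral>y. y * exp (\<theta> * y) \<partial>\<rho>)) (at \<theta>)" for \<theta>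
    unfolding M_def using assms(3,4) by (rule has_real_derivative_mgf)
  have pos: "\<forall>\<^sub>F n in sequentially. ln (ln (real n)) > 0" by real_asymp
  interpret prime_moments g M
  proof
    fix \<theta>
    have "(\<lambda>n. (\<integral>y. exp (\<theta> * y) \<partial>prime_law g n) * ((\<Sum>p\<in>primes_upto n. 1 / real p) / ln (ln (real n)))) \<longlonglongrightarrow> M \<theta> * 1"
      unfolding M_def by (intro tendsto_mult assms(5) sum_inverse_primes_asymp)
    moreover have "\<forall>\<^sub>F n in sequentially. (\<integral>y. exp (\<theta> * y) \<partial>prime_law g n) * ((\<Sum>p\<in>primes_upto n. 1 / real p) / ln (ln (real n)))
       = (\<Sum>p\<in>primes_upto n. exp (\<theta> * g p) / real p) / ln (ln (real n))"
      using eventually_ge_at_top[of 2]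
    proof eventually_elim
      case (elim n)
      have "(\<Sum>p\<in>primes_upto n. 1 / real p) > 0"
        using elim by (intro sum_pos2[where i = 2]) (auto simp: primes_upto_def)
      then show ?case by (simp add: integral_prime_law)
    qed
    ultimately show "(\<lambda>n. (\<Sum>p\<in>primes_upto n. exp (\<theta> * g p) / real p) / ln (ln (real n))) \<longlonglongrightarrow> M \<theta>"
      by (simp only: mult_1_right Lim_transform_eventually)
  qed
  interpret log_mgf_limit "\<lambda>n. distr (measure_pmf (pmf_of_set {1..n})) borel (\<lambda>v. g v / ln (ln (real n)))"
    "\<lambda>n. ln (ln (real n))" "\<lambda>\<theta>. M \<theta> - 1"
  proof (rule log_mgf_limit.intro)
    show "prob_space (distr (measure_pmf (pmf_of_set {1..n})) borel (\<lambda>v. g v / ln (ln (real n))))" for n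
      by (rule measure_pmf.prob_space_distr) simp
    show "filterlim (\<lambda>n. ln (ln (real n))) at_top sequentially" by real_asymp
    show "\<forall>\<^sub>F n in sequentially. integrable (distr (measure_pmf (pmf_of_set {1..n})) borel (\<lambda>v. g v / ln (ln (real n)))) (\<lambda>x. exp (ln (ln (real n)) * \<theta> * x))" for \<theta>
      using pos eventually_gt_at_top[of 0] by eventually_elim (intro integral_uniform_law(1), auto)
    have "isCont M \<theta>" for \<theta> using der DERIV_isCont by blast
    then have lim: "(\<lambda>n. log_mean_exp n (\<lambda>m. \<theta> * g m) / ln (ln (real n))) \<longlonglongrightarrow> M \<theta> - 1" for \<theta>
      using assms(1) by (rule log_mgf_asymp[rotated])
    show "(\<lambda>n. ln (\<integral>x. exp (ln (ln (real n)) * \<theta> * x) \<partial>distr (measure_pmf (pmf_of_set {1..n})) borel (\<lambda>v. g v / ln (ln (real n)))) / ln (ln (real n))) \<longlonglongrightarrow> M \<theta> - 1" for \<theta>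
    proof (rule Lim_transform_eventually[OF lim])
      show "\<forall>\<^sub>F n in sequentially. log_mean_exp n (\<lambda>m. \<theta> * g m) / ln (ln (real n)) =
        ln (\<integral>x. exp (ln (ln (real n)) * \<theta> * x) \<partial>distr (measure_pmf (pmf_of_set {1..n})) borel (\<lambda>v. g v / ln (ln (real n)))) / ln (ln (real n))"
        using pos eventually_gt_at_top[of 0] by eventually_elim (subst integral_uniform_law(2), auto)
    qed
  qed simp
  have "(\<lambda>\<theta>. M \<theta> - 1) differentiable (at \<theta>)" for \<theta>
    using der[of \<theta>] by (intro differentiable_diff) (auto simp: real_differentiable_def)
  then show ?thesis unfolding \<Lambda> by (rule gaertner_ellis)
qed

end
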